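(* Let $0<a<\frac13$, let $\zeta_1,\zeta_2\in C^1(\mathbb{T}^2)$ be real-valued functions on $\mathbb{T}^2=\mathbb{R}^2/(2\pi\mathbb{Z})^2$, and for $\delta_1,\delta_2\in\mathbb{R}$ let $G,\widetilde G:\mathbb{T}^2\to\mathbb{T}^2$ be given by $$G(x,y)=\bigl(x+2a\sin x+a\sin y+a\sin(x-y),\; y+a\sin x+2a\sin y+a\sin(y-x)\bigr)\pmod{2\pi},$$ $$\widetilde G(x,y)=G(x,y)+\bigl(\delta_1\zeta_1(x,y),\,\delta_2\zeta_2(x,y)\bigr)\pmod{2\pi}.$$ Then, for all sufficiently small $|\delta_1|+|\delta_2|$, almost all initial conditions on $\mathbb{T}^2$ (with respect to Lebesgue measure) approach, under iteration of $\widetilde G$, one of the two synchronised states corresponding to the sinks of $\widetilde G$, and do so exponentially fast.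
   Context: For sufficiently small $|\delta_1|+|\delta_2|$ (depending on $a,\zeta_1,\zeta_2$) there is a homeomorphism $h$ of $\mathbb{T}^2$ with $h\circ G=\widetilde G\circ h$, and $\widetilde G$ has exactly two sinks (hyperbolic asymptotically stable fixed points), namely $h(\frac{2\pi}{3},\frac{4\pi}{3})$ and $h(\frac{4\pi}{3},\frac{2\pi}{3})$. A point $z$ approaches a fixed point $p$ exponentially fast if there exist $C>0$, $\lambda\in(0,1)$ (possibly depending on $z$) with $d(\widetilde G^n(z),p)\le C\lambda^n$ for all $n\ge0$, $d$ being the flat distance on $\mathbb{T}^2$. *)

theory Defs
  imports "HOL-Analysis.Analysis"
begin

definition period_lattice :: "(real \<times> real) set" where
  "period_lattice = {(2 * pi * of_int m, 2 * pi * of_int n) | m n :: int. True}"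

lemma period_lattice_0: "0 \<in> period_lattice"
  unfolding period_lattice_def zero_prod_def
  by (intro CollectI exI[of _ 0]) simp

lemma period_lattice_minus: "u \<in> period_lattice \<Longrightarrow> - u \<in> period_lattice"
proof -
  assume "u \<in> period_lattice"
  then obtain m n :: int where "u = (2 * pi * of_int m, 2 * pi * of_int n)"
    by (auto simp: period_lattice_def)
  then have "- u = (2 * pi * of_int (- m), 2 * pi * of_int (- n))" by simp
  then show ?thesis unfolding period_lattice_def by blast
qed

lemma period_lattice_add:
  "u \<in> period_lattice \<Longrightarrow> v \<in> period_lattice \<Longrightarrow> u + v \<in> period_lattice"
proof -
  assume "u \<in> period_lattice" "v \<in> period_lattice"
  then obtain m n m' n' :: int where
    "u = (2 * pi * of_int m, 2 * pi * of_int n)" "v = (2 * pi * of_int m', 2 * pi * of_int n')"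
    by (auto simp: period_lattice_def)
  then have "u + v = (2 * pi * of_int (m + m'), 2 * pi * of_int (n + n'))"
    by (simp add: algebra_simps)
  then show ?thesis unfolding period_lattice_def by blast
qed

lemma period_lattice_diff:
  "u \<in> period_lattice \<Longrightarrow> v \<in> period_lattice \<Longrightarrow> u - v \<in> period_lattice"
  using period_lattice_add[OF _ period_lattice_minus] by fastforce

lemma closed_period_lattice: "closed period_lattice"
proof -
  have "period_lattice = (\<lambda>v. (fst v / (2 * pi), snd v / (2 * pi))) -` (\<int> \<times> \<int>)"
  proof (intro set_eqI iffI)
    fix v :: "real \<times> real"
    assume "v \<in> (\<lambda>v. (fst v / (2 * pi), snd v / (2 * pi))) -` (\<int> \<times> \<int>)"
    then obtain m n :: int where
      "fst v / (2 * pi) = of_int m" "snd v / (2 * pi) = of_int n"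
      by (auto elim!: Ints_cases)
    then have "v = (2 * pi * of_int m, 2 * pi * of_int n)"
      by (simp add: prod_eq_iff field_simps)
    then show "v \<in> period_lattice" unfolding period_lattice_def by blast
  qed (auto simp: period_lattice_def)
  moreover have "closed ((\<lambda>v :: real \<times> real. (fst v / (2 * pi), snd v / (2 * pi))) -` (\<int> \<times> \<int>))"
    by (intro closed_vimage closed_Times closed_Ints continuous_intros) auto
  ultimately show ?thesis by simp
qed

quotient_type torus = "real \<times> real" / "\<lambda>v w. v - w \<in> period_lattice"
  morphisms rep_torus torus_of
proof (rule equivpI)
  show "reflp (\<lambda>v w. v - w \<in> period_lattice)"
    by (simp add: reflp_def period_lattice_0)
  show "symp (\<lambda>v w. v - w \<in> period_lattice)"
    unfolding symp_def using period_lattice_minus by fastforce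
  show "transp (\<lambda>v w. v - w \<in> period_lattice)"
    unfolding transp_def
  proof (intro allI impI)
    fix u v w assume "u - v \<in> period_lattice" "v - w \<in> period_lattice"
    from period_lattice_add[OF this] show "u - w \<in> period_lattice" by simp
  qed
qed

lemma torus_of_eq_iff: "torus_of v = torus_of w \<longleftrightarrow> v - w \<in> period_lattice"
  by (rule torus.abs_eq_iff)

lemma torus_of_surj: "\<exists>v. torus_of v = p"
  by (metis Quotient_torus Quotient_abs_rep)

instantiation torus :: ab_group_add
begin

lift_definition zero_torus :: torus is "0" .

lift_definition plus_torus :: "torus \<Rightarrow> torus \<Rightarrow> torus" is "(+)"
proof -
  fix u v w x :: "real \<times> real"
  assume "u - v \<in> period_lattice" "w - x \<in> period_lattice"
  moreover have "(u + w) - (v + x) = (u - v) + (w - x)" by (rule add_diff_add)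
  ultimately show "(u + w) - (v + x) \<in> period_lattice" by (simp only: period_lattice_add)
qed

lift_definition uminus_torus :: "torus \<Rightarrow> torus" is "uminus"
proof -
  fix u v :: "real \<times> real"
  assume "u - v \<in> period_lattice"
  moreover have "- u - - v = - (u - v)" by simp
  ultimately show "- u - - v \<in> period_lattice" by (simp only: period_lattice_minus)
qed

lift_definition minus_torus :: "torus \<Rightarrow> torus \<Rightarrow> torus" is "(-)"
proof -
  fix u v w x :: "real \<times> real"
  assume "u - v \<in> period_lattice" "w - x \<in> period_lattice"
  moreover have "(u - w) - (v - x) = (u - v) - (w - x)" by simp
  ultimately show "(u - w) - (v - x) \<in> period_lattice" by (simp only: period_lattice_diff)
qed

instance
  by standard (transfer; simp add: period_lattice_0 algebra_simps)+

end

lemma torus_fibre: "{w. torus_of w = torus_of v} = (+) v ` period_lattice"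
proof (intro set_eqI iffI)
  fix w assume "w \<in> {w. torus_of w = torus_of v}"
  then have "w - v \<in> period_lattice" by (simp add: torus_of_eq_iff)
  then show "w \<in> (+) v ` period_lattice" by (intro image_eqI[of _ _ "w - v"]) auto
qed (auto simp: torus_of_eq_iff)

lemma closed_torus_fibre: "closed {w. torus_of w = p}"
proof -
  obtain v where "torus_of v = p" using torus_of_surj by blast
  with closed_translation[OF closed_period_lattice, of v] torus_fibre[of v] show ?thesis by simp
qed

lemma setdist_torus_fibre:
  "setdist {v. torus_of v = torus_of v0} {w. torus_of w = q} = infdist v0 {w. torus_of w = q}"
proof (rule antisym)
  let ?A = "{v. torus_of v = torus_of v0}" and ?B = "{w. torus_of w = q}"
  have ne: "?A \<noteq> {}" "?B \<noteq> {}" using torus_of_surj by auto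
  have "setdist ?A ?B \<le> setdist {v0} ?B" by (rule setdist_subset_left) auto
  then show "setdist ?A ?B \<le> infdist v0 ?B"
    by (simp add: infdist_eq_setdist)
  show "infdist v0 ?B \<le> setdist ?A ?B"
  proof (rule le_setdistI[OF ne])
    fix v w assume vw: "v \<in> ?A" "w \<in> ?B"
    then have "v - v0 \<in> period_lattice" by (simp add: torus_of_eq_iff)
    then have "w - (w - (v - v0)) \<in> period_lattice" by simp
    then have "torus_of (w - (v - v0)) = q" using vw by (metis mem_Collect_eq torus_of_eq_iff)
    then have "infdist v0 ?B \<le> dist v0 (w - (v - v0))" by (intro infdist_le) auto
    also have "\<dots> = dist v w" by (simp add: dist_norm algebra_simps)
    finally show "infdist v0 ?B \<le> dist v w" .
  qed
qed

text \<open>The flat distance is the quotient metric, i.e. the Euclidean distance between fibres.\<close>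

instantiation torus :: metric_space
begin

definition dist_torus :: "torus \<Rightarrow> torus \<Rightarrow> real" where
  "dist_torus p q = setdist {v. torus_of v = p} {w. torus_of w = q}"

definition uniformity_torus :: "(torus \<times> torus) filter" where
  "uniformity_torus = (INF e\<in>{0 <..}. principal {(x, y). dist x y < e})"

definition open_torus :: "torus set \<Rightarrow> bool" where
  "open_torus U \<longleftrightarrow> (\<forall>x\<in>U. eventually (\<lambda>(x', y). x' = x \<longrightarrow> y \<in> U) uniformity)"

instance
proof
  fix p q r :: torus
  obtain u v w where uvw: "torus_of u = p" "torus_of v = q" "torus_of w = r"
    using torus_of_surj by metis
  have D: "dist (torus_of x) s = infdist x {w. torus_of w = s}" for x s
    unfolding dist_torus_def by (rule setdist_torus_fibre)
  have ne: "{w. torus_of w = s} \<noteq> {}" for s using torus_of_surj by auto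
  show "dist p q = 0 \<longleftrightarrow> p = q"
    using D[of u q] uvw in_closed_iff_infdist_zero[OF closed_torus_fibre[of q] ne, of u] by auto
  show "dist p q \<le> dist p r + dist q r"
  proof -
    have "dist p q - dist r q \<le> setdist {u} {x. torus_of x = r}"
    proof (rule le_setdistI)
      fix u' w' assume "u' \<in> {u}" and w': "w' \<in> {x. torus_of x = r}"
      have "infdist u {x. torus_of x = q} \<le> infdist w' {x. torus_of x = q} + dist u w'"
        by (rule infdist_triangle)
      then show "dist p q - dist r q \<le> dist u' w'"
        using D[of u q] D[of w' q] uvw w' \<open>u' \<in> {u}\<close> by simp
    qed (use ne in auto)
    also have "\<dots> = dist p r"
      using D[of u r] uvw by (simp add: infdist_eq_setdist)
    also have "dist r q = dist q r"
      by (simp add: dist_torus_def setdist_sym)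
    finally show ?thesis by simp
  qed
qed (simp_all only: uniformity_torus_def open_torus_def)

end

lemma dist_torus_of_le: "dist (torus_of v) (torus_of w) \<le> dist v w"
  unfolding dist_torus_def by (rule setdist_le_dist) auto

lemma continuous_on_torus_of: "continuous_on A torus_of"
  by (rule continuous_onI) (meson dist_torus_of_le le_less_trans less_imp_le)

text \<open>Lebesgue measure on the torus, transported from a fundamental domain.\<close>

definition torus_lebesgue :: "torus measure" where
  "torus_lebesgue =
     distr (restrict_space lborel ({0..<2 * pi} \<times> {0..<2 * pi})) borel torus_of"

lemma measurable_torus_of:
  "torus_of \<in> measurable (restrict_space lborel ({0..<2 * pi} \<times> {0..<2 * pi})) borel"
  by (rule measurable_restrict_space1)
     (simp add: borel_measurable_continuous_onI continuous_on_torus_of)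

text \<open>Continuous differentiability of a function on the torus means that of its lift to the plane.\<close>

definition C1_torus :: "(torus \<Rightarrow> real) \<Rightarrow> bool" where
  "C1_torus \<zeta> \<longleftrightarrow>
     (\<exists>\<zeta>' :: real \<times> real \<Rightarrow> (real \<times> real) \<Rightarrow>\<^sub>L real. continuous_on UNIV \<zeta>' \<and>
        (\<forall>v. ((\<lambda>w. \<zeta> (torus_of w)) has_derivative blinfun_apply (\<zeta>' v)) (at v)))"

text \<open>The derivative at \<open>p\<close> of a torus map is the derivative of any lift of it to the plane that is
  differentiable at a representative of \<open>p\<close>; two such lifts differ near that point by a
  constant lattice vector.\<close>

definition torus_has_derivative ::
    "(torus \<Rightarrow> torus) \<Rightarrow> (real \<times> real \<Rightarrow> real \<times> real) \<Rightarrow> torus \<Rightarrow> bool" where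
  "torus_has_derivative F A p \<longleftrightarrow>
     (\<exists>\<Phi> v. torus_of v = p \<and> (\<forall>w. F (torus_of w) = torus_of (\<Phi> w)) \<and> (\<Phi> has_derivative A) (at v))"

text \<open>The complex number \<open>c\<close> is an eigenvalue of the complexification of \<open>A\<close>:
  the real and imaginary parts of \<open>A (u + \<i> v) = c (u + \<i> v)\<close> for some \<open>u + \<i> v \<noteq> 0\<close>.\<close>

definition complex_eigenvalue :: "('a :: real_vector \<Rightarrow> 'a) \<Rightarrow> complex \<Rightarrow> bool" where
  "complex_eigenvalue A c \<longleftrightarrow>
     (\<exists>u v. (u, v) \<noteq> (0, 0) \<and> A u = Re c *\<^sub>R u - Im c *\<^sub>R v \<and> A v = Im c *\<^sub>R u + Re c *\<^sub>R v)"

definition hyperbolic_fixed_point :: "(torus \<Rightarrow> torus) \<Rightarrow> torus \<Rightarrow> bool" where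
  "hyperbolic_fixed_point F p \<longleftrightarrow>
     F p = p \<and> (\<exists>A. torus_has_derivative F A p \<and> (\<forall>c. complex_eigenvalue A c \<longrightarrow> cmod c \<noteq> 1))"

definition asymptotically_stable :: "('a :: topological_space \<Rightarrow> 'a) \<Rightarrow> 'a \<Rightarrow> bool" where
  "asymptotically_stable F p \<longleftrightarrow>
     (\<forall>U. open U \<and> p \<in> U \<longrightarrow> (\<exists>V. open V \<and> p \<in> V \<and> (\<forall>z\<in>V. \<forall>n. (F ^^ n) z \<in> U))) \<and>
     (\<exists>U. open U \<and> p \<in> U \<and> (\<forall>z\<in>U. (\<lambda>n. (F ^^ n) z) \<longlonglongrightarrow> p))"

definition sink :: "(torus \<Rightarrow> torus) \<Rightarrow> torus \<Rightarrow> bool" where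
  "sink F p \<longleftrightarrow> hyperbolic_fixed_point F p \<and> asymptotically_stable F p"

definition approaches_exponentially :: "('a :: metric_space \<Rightarrow> 'a) \<Rightarrow> 'a \<Rightarrow> 'a \<Rightarrow> bool" where
  "approaches_exponentially F z p \<longleftrightarrow>
     (\<exists>C>0. \<exists>r. 0 < r \<and> r < 1 \<and> (\<forall>n. dist ((F ^^ n) z) p \<le> C * r ^ n))"

lemma diff_in_period_latticeE:
  assumes "v - w \<in> period_lattice"
  obtains m n :: int where
    "fst v = fst w + 2 * pi * of_int m" "snd v = snd w + 2 * pi * of_int n"
proof -
  obtain m n :: int where "v - w = (2 * pi * of_int m, 2 * pi * of_int n)"
    using assms by (auto simp: period_lattice_def)
  then have "fst v - fst w = 2 * pi * of_int m" "snd v - snd w = 2 * pi * of_int n"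
    by (metis fst_conv fst_diff, metis snd_conv snd_diff)
  then show thesis by (intro that[of m n]) simp_all
qed

lemma sin_plus_int_period: "sin (x + 2 * pi * of_int m) = sin x"
  by (simp add: sin_add)

lift_definition G_map :: "real \<Rightarrow> torus \<Rightarrow> torus" is
  "\<lambda>a (x, y). (x + 2 * a * sin x + a * sin y + a * sin (x - y),
               y + a * sin x + 2 * a * sin y + a * sin (y - x))"
proof -
  fix a :: real and v w :: "real \<times> real"
  assume "v - w \<in> period_lattice"
  then obtain m n where mn:
    "fst v = fst w + 2 * pi * of_int m" "snd v = snd w + 2 * pi * of_int n"
    by (rule diff_in_period_latticeE)
  have "sin (fst v - snd v) = sin (fst w - snd w)" "sin (snd v - fst v) = sin (snd w - fst w)"
    using sin_plus_int_period[of "fst w - snd w" "m - n"]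
      sin_plus_int_period[of "snd w - fst w" "n - m"]
    by (simp_all add: mn algebra_simps)
  moreover have "sin (fst v) = sin (fst w)" "sin (snd v) = sin (snd w)"
    by (simp_all add: mn sin_plus_int_period)
  ultimately show
    "(case v of (x, y) \<Rightarrow> (x + 2 * a * sin x + a * sin y + a * sin (x - y),
                           y + a * sin x + 2 * a * sin y + a * sin (y - x))) -
     (case w of (x, y) \<Rightarrow> (x + 2 * a * sin x + a * sin y + a * sin (x - y),
                           y + a * sin x + 2 * a * sin y + a * sin (y - x))) \<in> period_lattice"
    using \<open>v - w \<in> period_lattice\<close> by (cases v; cases w) simp
qed

definition G_pert ::
    "real \<Rightarrow> (torus \<Rightarrow> real) \<Rightarrow> (torus \<Rightarrow> real) \<Rightarrow> real \<Rightarrow> real \<Rightarrow> torus \<Rightarrow> torus" where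
  "G_pert a \<zeta>1 \<zeta>2 \<delta>1 \<delta>2 z = G_map a z + torus_of (\<delta>1 * \<zeta>1 z, \<delta>2 * \<zeta>2 z)"

end

theory Submission
  imports Defs
begin

text \<open>Put \<open>W(x, y) = cos x + cos y + cos (x - y)\<close>. Then \<open>G\<close> is the gradient step
  \<open>v \<mapsto> v - a M \<nabla>W(v)\<close> with \<open>M = [[2, 1], [1, 2]]\<close>, and \<open>W\<close> stays a Lyapunov function of the perturbed
  map away from the critical points of \<open>W\<close>. Near them \<open>W\<close> is almost constant and it
  cannot climb back to a critical level it has left, so every orbit finally stays close to one
  critical point. The minima are attracting because the map contracts there. Near the other critical
  points minus the Hessian form, evaluated at the difference of two orbits, grows by a factor at
  every step, so two trapped orbits differ in the cone where it is nonpositive; hence the trapped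
  points form a Lipschitz graph, a null set. Since \<open>a < 1/3\<close> makes the lift strongly monotone for the inner product of \<open>M\<inverse>\<close>, it has a Lipschitz inverse, and the
  preimages of null sets are null. An open set therefore always contains points attracted to one of
  the two sinks, which shows that no other asymptotically stable point exists.\<close>

subsection \<open>The gradient field\<close>

text \<open>One inequality explains the role of \<open>a\<close>: every cosine has second derivative
  at most 1, so the Hessian of \<open>W\<close> is at most \<open>3 M^-1\<close>. In the inner
  product of \<open>M^-1\<close> the unperturbed step therefore lowers \<open>W\<close> when
  \<open>a < 2/3\<close> and is strongly monotone when \<open>a < 1/3\<close>. The constants are
  chosen in a fixed order: the radius \<open>r\<close> from \<open>a\<close> alone, so that
  linearisation errors are a small multiple of \<open>a\<close>; then the admissible error per step
  from \<open>r\<close>, by compactness of the torus; then the threshold for the deltas, from a sup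
  bound and a Lipschitz bound of the perturbation. The orbit estimates see the perturbation only
  through these two bounds and compare pairs of orbits of the lift, which takes the place of
  invariant manifold theory. Beyond them, differentiability serves for the eigenvalues at the sinks.
  The statement speaks of every conjugacy \<open>h\<close>: asymptotic stability is invariant under
  conjugacy, so \<open>h\<close> takes the two synchronised states of \<open>G\<close> to
  asymptotically stable points of the perturbed map, and there are exactly two of those.\<close>

text \<open>\<open>sin_field\<close> is the negative gradient of \<open>energy\<close>. At \<open>c\<close>, its derivative is
  \<open>linear_field (cosines c)\<close>, and \<open>hess (cosines c)\<close> is the negative of the Hessian form of \<open>energy\<close>.\<close>

definition sin_field :: "real \<times> real \<Rightarrow> real \<times> real" where
  "sin_field v = (sin (fst v) + sin (fst v - snd v), sin (snd v) - sin (fst v - snd v))"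

definition energy :: "real \<times> real \<Rightarrow> real" where
  "energy v = cos (fst v) + cos (snd v) + cos (fst v - snd v)"

definition coupling :: "real \<times> real \<Rightarrow> real \<times> real" where
  "coupling w = (2 * fst w + snd w, fst w + 2 * snd w)"

definition linear_field :: "real \<times> real \<times> real \<Rightarrow> real \<times> real \<Rightarrow> real \<times> real" where
  "linear_field = (\<lambda>(k1, k2, k3) d.
     (k1 * fst d + k3 * (fst d - snd d), k2 * snd d - k3 * (fst d - snd d)))"

definition cosines :: "real \<times> real \<Rightarrow> real \<times> real \<times> real" where
  "cosines c = (cos (fst c), cos (snd c), cos (fst c - snd c))"

definition hess :: "real \<times> real \<times> real \<Rightarrow> real \<times> real \<Rightarrow> real" where
  "hess = (\<lambda>(k1, k2, k3) d. k1 * (fst d)\<^sup>2 + k2 * (snd d)\<^sup>2 + k3 * (fst d - snd d)\<^sup>2)"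

section \<open>Elementary bounds, descent of the energy, and monotonicity\<close>

lemma norm_prod_le_abs: "norm (w :: real \<times> real) \<le> \<bar>fst w\<bar> + \<bar>snd w\<bar>"
  by (metis norm_Pair_le prod.collapse real_norm_def)

lemma abs_fst_le_norm: "\<bar>fst (w :: real \<times> real)\<bar> \<le> norm w"
  and abs_snd_le_norm: "\<bar>snd (w :: real \<times> real)\<bar> \<le> norm w"
  using norm_fst_le[of "fst w" "snd w"] norm_snd_le[of "snd w" "fst w"] by simp_all

lemma norm_prod_sq: "(norm (w :: real \<times> real))\<^sup>2 = (fst w)\<^sup>2 + (snd w)\<^sup>2"
  by (cases w) (simp add: norm_Pair)

lemma abs_sin_diff_le: "\<bar>sin x - sin y\<bar> \<le> \<bar>x - y\<bar>" for x y :: real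
  using field_differentiable_bound[of UNIV sin cos 1 x y] by (auto intro: DERIV_sin)

lemma abs_cos_diff_le: "\<bar>cos x - cos y\<bar> \<le> \<bar>x - y\<bar>" for x y :: real
  using field_differentiable_bound[of UNIV cos "\<lambda>x. - sin x" 1 x y] by (auto intro: DERIV_cos)

lemma sin_diff_linearization:
  fixes x y z r :: real
  assumes "\<bar>x - z\<bar> \<le> r" "\<bar>y - z\<bar> \<le> r"
  shows "\<bar>sin x - sin y - cos z * (x - y)\<bar> \<le> r * \<bar>x - y\<bar>"
proof -
  have "norm ((sin x - cos z * x) - (sin y - cos z * y)) \<le> r * norm (x - y)"
  proof (rule field_differentiable_bound[where S = "{z - r..z + r}" and f' = "\<lambda>t. cos t - cos z"])
    fix t assume "t \<in> {z - r..z + r}"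
    then show "norm (cos t - cos z) \<le> r"
      using abs_cos_diff_le[of t z] by auto
  qed (use assms in \<open>auto intro!: derivative_eq_intros\<close>)
  then show ?thesis by (simp add: algebra_simps)
qed

lemma cos_add_le: "cos (x + t) \<le> cos x - t * sin x + t\<^sup>2 / 2" for x t :: real
proof -
  have *: "cos (x + t) \<le> cos x - t * sin x + t\<^sup>2 / 2" if "t \<ge> 0" for x t :: real
  proof -
    let ?h = "\<lambda>t. cos x - t * sin x + t\<^sup>2 / 2 - cos (x + t)"
    have "?h 0 \<le> ?h t"
    proof (rule DERIV_nonneg_imp_nondecreasing[OF that])
      fix u assume "0 \<le> u" "u \<le> t"
      have "(?h has_real_derivative (u - sin x + sin (x + u))) (at u)"
        by (auto intro!: derivative_eq_intros)
      moreover have "u - sin x + sin (x + u) \<ge> 0"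
        using abs_sin_diff_le[of "x + u" x] \<open>0 \<le> u\<close> by auto
      ultimately show "\<exists>y. (?h has_real_derivative y) (at u) \<and> 0 \<le> y" by blast
    qed
    then show ?thesis by simp
  qed
  show ?thesis
  proof (cases "t \<ge> 0")
    case False
    then show ?thesis using *[of "- t" "- x"] cos_minus[of "x + t"] by simp
  qed (rule *)
qed

text \<open>Sum of three one-dimensional bounds. The quadratic term is
  \<open>s^2/2 + t^2/2 + (s - t)^2/2\<close>, which is 3/2 times the form of the inverse coupling
  matrix; this is why it combines so well with a step along
  \<open>coupling (sin_field v)\<close>.\<close>

lemma energy_add_le:
  "energy (v + d) \<le> energy v - sin_field v \<bullet> d + ((fst d)\<^sup>2 + (snd d)\<^sup>2 - fst d * snd d)"
proof -
  obtain x y where v: "v = (x, y)" by force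
  obtain s t where d: "d = (s, t)" by force
  have eq: "x + s - (y + t) = (x - y) + (s - t)" by simp
  have "cos (x + s - (y + t)) \<le> cos (x - y) - (s - t) * sin (x - y) + (s - t)\<^sup>2 / 2"
    unfolding eq by (rule cos_add_le)
  moreover have "energy (v + d) = cos (x + s) + cos (y + t) + cos (x + s - (y + t))"
    and "energy v = cos x + cos y + cos (x - y)"
    by (simp_all add: v d energy_def)
  moreover have "sin_field v \<bullet> d = s * sin x + t * sin y + (s - t) * sin (x - y)"
    by (simp add: v d sin_field_def algebra_simps)
  moreover have "(fst d)\<^sup>2 + (snd d)\<^sup>2 - fst d * snd d = s\<^sup>2 / 2 + t\<^sup>2 / 2 + (s - t)\<^sup>2 / 2"
    by (simp add: d power2_eq_square field_simps)
  ultimately show ?thesis using cos_add_le[of x s] cos_add_le[of y t] by linarith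
qed

text \<open>Without \<open>e\<close>, the step gains \<open>2 a N\<close> to first order and loses
  \<open>3 a^2 N\<close> to second order, where \<open>2 N\<close> is the coupling form of the
  gradient. From \<open>3 a < 1\<close> at least \<open>a N\<close> remains, and \<open>N\<close> is
  at least half the squared norm. The mixed terms in \<open>e\<close> collect into the factor
  \<open>1 - 3 a\<close>, which lies between 0 and 1.\<close>

lemma energy_descent:
  fixes a :: real
  assumes "0 < a" "a < 1 / 3"
  shows "energy (v + a *\<^sub>R coupling (sin_field v) + e) \<le>
    energy v - a / 2 * (norm (sin_field v))\<^sup>2 + norm (sin_field v) * norm e + 2 * (norm e)\<^sup>2"
proof -
  obtain p q where n: "sin_field v = (p, q)" by force
  obtain s t where e: "e = (s, t)" by force
  define d where "d = a *\<^sub>R coupling (sin_field v) + e"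
  define N where "N = p\<^sup>2 + q\<^sup>2 + p * q"
  have d': "d = (a * (2 * p + q) + s, a * (p + 2 * q) + t)"
    by (simp add: d_def coupling_def n e)
  have "sin_field v \<bullet> d = 2 * a * N + (p * s + q * t)"
    by (simp add: n d' N_def power2_eq_square algebra_simps)
  moreover have "(fst d)\<^sup>2 + (snd d)\<^sup>2 - fst d * snd d
     = 3 * a\<^sup>2 * N + 3 * a * (p * s + q * t) + (s\<^sup>2 + t\<^sup>2 - s * t)"
    by (simp add: d' N_def power2_eq_square algebra_simps)
  ultimately have E: "energy (v + d) \<le> energy v - (2 * a - 3 * a\<^sup>2) * N
      - (1 - 3 * a) * (p * s + q * t) + (s\<^sup>2 + t\<^sup>2 - s * t)"
    using energy_add_le[of v d] by (simp add: algebra_simps)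
  have "N \<ge> (p\<^sup>2 + q\<^sup>2) / 2" unfolding N_def
    using zero_le_power2[of "p + q"] by (simp add: power2_eq_square algebra_simps)
  moreover have "a \<le> 2 * a - 3 * a\<^sup>2"
  proof -
    have "a * (3 * a) \<le> a * 1" by (rule mult_left_mono) (use assms in auto)
    then show ?thesis by (simp add: power2_eq_square)
  qed
  moreover have "0 \<le> (p\<^sup>2 + q\<^sup>2) / 2" by simp
  ultimately have 1: "(2 * a - 3 * a\<^sup>2) * N \<ge> a / 2 * (p\<^sup>2 + q\<^sup>2)"
    using mult_mono[of a "2 * a - 3 * a\<^sup>2" "(p\<^sup>2 + q\<^sup>2) / 2" N] assms by linarith
  have "\<bar>p * s + q * t\<bar> \<le> norm (sin_field v) * norm e"
    using Cauchy_Schwarz_ineq2[of "sin_field v" e] by (simp add: n e)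
  moreover have "\<bar>(1 - 3 * a) * (p * s + q * t)\<bar> \<le> \<bar>p * s + q * t\<bar>"
    unfolding abs_mult by (rule mult_left_le_one_le) (use assms in auto)
  ultimately have 2: "- ((1 - 3 * a) * (p * s + q * t)) \<le> norm (sin_field v) * norm e"
    by linarith
  have 3: "s\<^sup>2 + t\<^sup>2 - s * t \<le> 2 * (norm e)\<^sup>2"
  proof -
    have "2 * (s\<^sup>2 + t\<^sup>2) - (s\<^sup>2 + t\<^sup>2 - s * t) = (s\<^sup>2 + t\<^sup>2 + (s + t)\<^sup>2) / 2"
      by (simp add: power2_eq_square field_simps)
    also have "\<dots> \<ge> 0" by simp
    finally show ?thesis by (simp add: norm_prod_sq e)
  qed
  have eq: "(norm (sin_field v))\<^sup>2 = p\<^sup>2 + q\<^sup>2" by (simp add: norm_prod_sq n)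
  have d_eq: "v + a *\<^sub>R coupling (sin_field v) + e = v + d" by (simp add: d_def)
  show ?thesis unfolding d_eq eq using E 1 2 3 by linarith
qed

lemma norm_coupling_le: "norm (coupling w) \<le> 6 * norm w"
  using norm_prod_le_abs[of "coupling w"] abs_fst_le_norm[of w] abs_snd_le_norm[of w]
  unfolding coupling_def by simp

lemma coupling_diff: "coupling (v - w) = coupling v - coupling w"
  by (simp add: coupling_def algebra_simps prod_eq_iff)

lemma sin_field_linearization:
  assumes "u \<in> cball c r" "v \<in> cball c r"
  shows "norm (sin_field u - sin_field v - linear_field (cosines c) (u - v)) \<le> 10 * r * norm (u - v)"
proof -
  have r: "r \<ge> 0" using assms(1) by (smt (verit) mem_cball zero_le_dist)
  have b: "\<bar>fst u - fst c\<bar> \<le> r" "\<bar>fst v - fst c\<bar> \<le> r" "\<bar>snd u - snd c\<bar> \<le> r" "\<bar>snd v - snd c\<bar> \<le> r"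
    using assms abs_fst_le_norm[of "u - c"] abs_fst_le_norm[of "v - c"]
      abs_snd_le_norm[of "u - c"] abs_snd_le_norm[of "v - c"]
    by (auto simp: dist_norm norm_minus_commute)
  define A where "A = sin (fst u) - sin (fst v) - cos (fst c) * (fst u - fst v)"
  define B where "B = sin (snd u) - sin (snd v) - cos (snd c) * (snd u - snd v)"
  define C where "C = sin (fst u - snd u) - sin (fst v - snd v)
    - cos (fst c - snd c) * ((fst u - snd u) - (fst v - snd v))"
  let ?N = "norm (u - v)"
  have n: "\<bar>fst u - fst v\<bar> \<le> ?N" "\<bar>snd u - snd v\<bar> \<le> ?N"
    using abs_fst_le_norm[of "u - v"] abs_snd_le_norm[of "u - v"] by auto
  have "\<bar>A\<bar> \<le> r * \<bar>fst u - fst v\<bar>" "\<bar>B\<bar> \<le> r * \<bar>snd u - snd v\<bar>"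
    unfolding A_def B_def by (intro sin_diff_linearization b)+
  then have AB: "\<bar>A\<bar> \<le> r * ?N" "\<bar>B\<bar> \<le> r * ?N"
    using n r by (meson mult_left_mono order_trans)+
  \<comment> \<open>The difference of the coordinates lies within \<open>2 * r\<close> of its value
    at \<open>c\<close> and varies by at most twice the norm, hence the factor 4. As
    \<open>C\<close> enters both components, the total is \<open>1 + 1 + 2 * 4 = 10\<close>.\<close>
  have "\<bar>C\<bar> \<le> 2 * r * \<bar>(fst u - snd u) - (fst v - snd v)\<bar>"
    unfolding C_def by (intro sin_diff_linearization) (use b in linarith)+
  also have "\<dots> \<le> 2 * r * (2 * ?N)"
    by (intro mult_left_mono) (use n r in auto)
  finally have C: "\<bar>C\<bar> \<le> 4 * (r * ?N)" by simp
  have "sin_field u - sin_field v - linear_field (cosines c) (u - v) = (A + C, B - C)"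
    by (simp add: sin_field_def linear_field_def cosines_def A_def B_def C_def algebra_simps)
  also have "norm \<dots> \<le> \<bar>A + C\<bar> + \<bar>B - C\<bar>" using norm_prod_le_abs[of "(A + C, B - C)"] by simp
  also have "\<dots> \<le> 10 * (r * ?N)" using AB C by linarith
  finally show ?thesis by simp
qed

text \<open>Strong monotonicity with respect to three times the inverse coupling matrix.\<close>

lemma sin_field_monotone:
  fixes u v :: "real \<times> real" and a :: real
  assumes "0 < a" "a < 1 / 3"
    and e: "norm (p - q) \<le> \<eta> * norm (u - v)" and \<eta>: "6 * \<eta> \<le> 1 - 3 * a"
  shows "(1 - 3 * a) * norm (u - v) \<le>
    6 * norm ((u + a *\<^sub>R coupling (sin_field u) + p) - (v + a *\<^sub>R coupling (sin_field v) + q))"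
proof -
  define b where "b = (\<lambda>w d :: real \<times> real. fst w * fst d + snd w * snd d + (fst w - snd w) * (fst d - snd d))"
  have b_le: "\<bar>b w d\<bar> \<le> 3 * norm w * norm d" for w d
  proof -
    have "b w d = w \<bullet> d + (fst w - snd w, snd w - fst w) \<bullet> d"
      by (cases w; cases d) (simp add: b_def algebra_simps)
    moreover have "norm (fst w - snd w, snd w - fst w) \<le> 2 * norm w"
    proof (rule power2_le_imp_le)
      have "2 * (fst w - snd w)\<^sup>2 \<le> 4 * ((fst w)\<^sup>2 + (snd w)\<^sup>2)"
        using zero_le_power2[of "fst w + snd w"] by (simp add: power2_eq_square algebra_simps)
      then show "(norm (fst w - snd w, snd w - fst w))\<^sup>2 \<le> (2 * norm w)\<^sup>2"
        by (simp add: norm_prod_sq power_mult_distrib power2_commute[of "snd w"])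
    qed simp
    then have "\<bar>(fst w - snd w, snd w - fst w) \<bullet> d\<bar> \<le> 2 * norm w * norm d"
      using Cauchy_Schwarz_ineq2[of "(fst w - snd w, snd w - fst w)" d]
      by (meson mult_right_mono norm_ge_zero order_trans)
    ultimately show ?thesis using Cauchy_Schwarz_ineq2[of w d] by linarith
  qed
  define d where "d = u - v"
  define D where "D = (u + a *\<^sub>R coupling (sin_field u) + p) - (v + a *\<^sub>R coupling (sin_field v) + q)"
  have sin_ge: "(sin x - sin y) * (x - y) \<ge> - ((x - y)\<^sup>2)" for x y :: real
  proof -
    have "\<bar>(sin x - sin y) * (x - y)\<bar> \<le> \<bar>x - y\<bar> * \<bar>x - y\<bar>"
      unfolding abs_mult by (intro mult_right_mono abs_sin_diff_le) auto
    then show ?thesis by (simp add: power2_eq_square abs_le_iff)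
  qed
  define R where "R = (sin (fst u) - sin (fst v)) * (fst u - fst v)
    + (sin (snd u) - sin (snd v)) * (snd u - snd v)
    + (sin (fst u - snd u) - sin (fst v - snd v)) * ((fst u - snd u) - (fst v - snd v))"
  have "R \<ge> - b d d"
    using sin_ge[of "fst u" "fst v"] sin_ge[of "snd u" "snd v"] sin_ge[of "fst u - snd u" "fst v - snd v"]
    by (simp add: R_def b_def d_def power2_eq_square algebra_simps)
  then have "3 * a * R \<ge> 3 * a * (- b d d)" by (intro mult_left_mono) (use assms in auto)
  \<comment> \<open>\<open>b\<close> is the form of three times the inverse coupling matrix, so
    \<open>b (coupling w) d\<close> is \<open>3 * (w \<bullet> d)\<close>. With \<open>w\<close> the
    difference of the two gradients this inner product is \<open>R\<close>, a sum of three
    one-dimensional terms.\<close>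
  moreover have "b D d = b d d + 3 * a * R + b (p - q) d"
    by (simp add: b_def D_def d_def R_def coupling_def sin_field_def algebra_simps)
  moreover have "\<bar>b (p - q) d\<bar> \<le> 3 * \<eta> * (norm d)\<^sup>2"
  proof -
    have "\<bar>b (p - q) d\<bar> \<le> 3 * norm (p - q) * norm d" by (rule b_le)
    also have "\<dots> \<le> 3 * (\<eta> * norm d) * norm d"
      by (intro mult_right_mono mult_left_mono) (use e in \<open>auto simp: d_def\<close>)
    finally show ?thesis by (simp add: power2_eq_square)
  qed
  ultimately have "b D d \<ge> (1 - 3 * a) * b d d - 3 * \<eta> * (norm d)\<^sup>2"
    by (simp add: algebra_simps)
  moreover have "b d d \<ge> (norm d)\<^sup>2"
    unfolding norm_prod_sq b_def by (simp add: power2_eq_square)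
  then have "(1 - 3 * a) * b d d \<ge> (1 - 3 * a) * (norm d)\<^sup>2"
    by (intro mult_left_mono) (use assms in auto)
  moreover have "6 * \<eta> * (norm d)\<^sup>2 \<le> (1 - 3 * a) * (norm d)\<^sup>2"
    by (intro mult_right_mono \<eta>) auto
  moreover have "b D d \<le> 3 * norm D * norm d" using b_le[of D d] by linarith
  ultimately have "(1 - 3 * a) * norm d * norm d \<le> 6 * norm D * norm d"
    by (simp add: power2_eq_square algebra_simps)
  then show ?thesis
    unfolding D_def[symmetric] d_def[symmetric]
    by (cases "d = 0") auto
qed

subsection \<open>Critical points and pseudo-orbits\<close>

lemma sin_field_lipschitz: "norm (sin_field u - sin_field v) \<le> 6 * norm (u - v)"
proof -
  define A where "A = sin (fst u) - sin (fst v)"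
  define B where "B = sin (snd u) - sin (snd v)"
  define C where "C = sin (fst u - snd u) - sin (fst v - snd v)"
  have "sin_field u - sin_field v = (A + C, B - C)"
    by (simp add: sin_field_def A_def B_def C_def)
  then have "norm (sin_field u - sin_field v) \<le> \<bar>A\<bar> + \<bar>B\<bar> + 2 * \<bar>C\<bar>"
    using norm_prod_le_abs[of "(A + C, B - C)"] by simp
  moreover have "\<bar>fst u - snd u - (fst v - snd v)\<bar> \<le> \<bar>fst u - fst v\<bar> + \<bar>snd u - snd v\<bar>"
    by linarith
  then have "\<bar>C\<bar> \<le> \<bar>fst u - fst v\<bar> + \<bar>snd u - snd v\<bar>"
    unfolding C_def using abs_sin_diff_le order_trans by blast
  moreover have "\<bar>A\<bar> \<le> \<bar>fst u - fst v\<bar>" "\<bar>B\<bar> \<le> \<bar>snd u - snd v\<bar>"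
    unfolding A_def B_def by (rule abs_sin_diff_le)+
  moreover have "\<bar>fst u - fst v\<bar> \<le> norm (u - v)" "\<bar>snd u - snd v\<bar> \<le> norm (u - v)"
    using abs_fst_le_norm[of "u - v"] abs_snd_le_norm[of "u - v"] by simp_all
  ultimately show ?thesis by linarith
qed

lemma energy_lipschitz: "\<bar>energy u - energy v\<bar> \<le> 4 * norm (u - v)"
proof -
  define A where "A = cos (fst u) - cos (fst v)"
  define B where "B = cos (snd u) - cos (snd v)"
  define C where "C = cos (fst u - snd u) - cos (fst v - snd v)"
  have "energy u - energy v = A + B + C"
    by (simp add: energy_def A_def B_def C_def)
  moreover have "\<bar>fst u - snd u - (fst v - snd v)\<bar> \<le> \<bar>fst u - fst v\<bar> + \<bar>snd u - snd v\<bar>"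
    by linarith
  then have "\<bar>C\<bar> \<le> \<bar>fst u - fst v\<bar> + \<bar>snd u - snd v\<bar>"
    unfolding C_def using abs_cos_diff_le order_trans by blast
  moreover have "\<bar>A\<bar> \<le> \<bar>fst u - fst v\<bar>" "\<bar>B\<bar> \<le> \<bar>snd u - snd v\<bar>"
    unfolding A_def B_def by (rule abs_cos_diff_le)+
  moreover have "\<bar>fst u - fst v\<bar> \<le> norm (u - v)" "\<bar>snd u - snd v\<bar> \<le> norm (u - v)"
    using abs_fst_le_norm[of "u - v"] abs_snd_le_norm[of "u - v"] by simp_all
  ultimately show ?thesis by linarith
qed

lemma energy_ge: "energy v \<ge> -3"
  using cos_ge_minus_one[of "fst v"] cos_ge_minus_one[of "snd v"] cos_ge_minus_one[of "fst v - snd v"]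
  unfolding energy_def by linarith

lemma sin_field_periodic:
  assumes "l \<in> period_lattice"
  shows "sin_field (v + l) = sin_field v"
proof -
  obtain m n :: int where l: "fst (v + l) = fst v + 2 * pi * of_int m" "snd (v + l) = snd v + 2 * pi * of_int n"
    using diff_in_period_latticeE[of "v + l" v] assms by auto
  have "fst (v + l) - snd (v + l) = fst v - snd v + 2 * pi * of_int (m - n)"
    by (simp only: l) (simp add: algebra_simps)
  then have "sin (fst (v + l) - snd (v + l)) = sin (fst v - snd v)"
    by (simp only: sin_plus_int_period)
  then show ?thesis unfolding sin_field_def by (simp only: l sin_plus_int_period)
qed

lemma period_lattice_translate:
  obtains l where "l \<in> period_lattice" "v + l \<in> {0..<2 * pi} \<times> {0..<2 * pi}"
proof -
  have *: "0 \<le> x - 2 * pi * of_int \<lfloor>x / (2 * pi)\<rfloor>" "x - 2 * pi * of_int \<lfloor>x / (2 * pi)\<rfloor> < 2 * pi" for x :: real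
  proof -
    have "2 * pi * of_int \<lfloor>x / (2 * pi)\<rfloor> \<le> 2 * pi * (x / (2 * pi))"
      by (intro mult_left_mono) auto
    then show "0 \<le> x - 2 * pi * of_int \<lfloor>x / (2 * pi)\<rfloor>" by simp
    have "2 * pi * (x / (2 * pi)) < 2 * pi * (of_int \<lfloor>x / (2 * pi)\<rfloor> + 1)"
      by (intro mult_strict_left_mono) auto
    then show "x - 2 * pi * of_int \<lfloor>x / (2 * pi)\<rfloor> < 2 * pi" by (simp add: algebra_simps)
  qed
  show thesis
  proof (rule that)
    show "(2 * pi * of_int (- \<lfloor>fst v / (2 * pi)\<rfloor>), 2 * pi * of_int (- \<lfloor>snd v / (2 * pi)\<rfloor>)) \<in> period_lattice"
      unfolding period_lattice_def by blast
  qed (use *[of "fst v"] *[of "snd v"] in \<open>auto simp: mem_Times_iff\<close>)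
qed

section \<open>Classification of the critical points and distance to them\<close>

text \<open>At a zero, \<open>sin y\<close> and \<open>sin (x - y)\<close> both equal
  \<open>- sin x\<close>; the addition formula turns this into
  \<open>sin x * (cos x + cos y + 1) = 0\<close>. If the second factor vanishes, the cosines have
  equal squares and sum -1, so they agree.\<close>

lemma sin_field_eq_0_cases:
  assumes "sin_field c = 0"
  shows "sin (fst c) = 0 \<and> sin (snd c) = 0 \<or>
     cos (fst c) = - 1/2 \<and> cos (snd c) = - 1/2 \<and> sin (snd c) = - sin (fst c)"
proof -
  obtain x y where c: "c = (x, y)" by force
  have eq: "sin (x - y) = - sin x" "sin y = - sin x"
    using assms by (auto simp: c sin_field_def zero_prod_def)
  then have "sin x * (cos x + cos y + 1) = 0"
    by (simp add: sin_diff algebra_simps)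
  then consider "sin x = 0" | "cos x + cos y = - 1" by force
  then show ?thesis
  proof cases
    case 2
    have "(cos x)\<^sup>2 = (cos y)\<^sup>2" using eq by (simp add: cos_squared_eq)
    with 2 have "cos x = cos y" by (auto simp: power2_eq_iff)
    with 2 eq show ?thesis by (simp add: c)
  qed (use eq in \<open>simp add: c\<close>)
qed

definition synchronised_cosines :: "real \<times> real \<times> real" where
  "synchronised_cosines = (- 1/2, - 1/2, - 1/2)"

text \<open>\<open>(1, 1, 1)\<close> belongs to the maxima of \<open>energy\<close>, at level 3; the
  other triples belong to the saddles, at level -1.\<close>

definition unstable_cosines :: "(real \<times> real \<times> real) set" where
  "unstable_cosines = {(1, 1, 1), (- 1, - 1, 1), (1, - 1, - 1), (- 1, 1, - 1)}"

text \<open>The explicit position of the unstable points is recorded because it shows that they are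
  countable and that distinct ones are at least \<open>pi\<close> apart.\<close>

lemma cosines_critical:
  assumes "sin_field c = 0"
  shows "cosines c = synchronised_cosines \<or>
    cosines c \<in> unstable_cosines \<and> (\<exists>m n :: int. c = (of_int m * pi, of_int n * pi))"
proof -
  obtain x y where c: "c = (x, y)" by force
  from sin_field_eq_0_cases[OF assms] show ?thesis
  proof
    assume s: "sin (fst c) = 0 \<and> sin (snd c) = 0"
    then have "(cos x)\<^sup>2 = 1" "(cos y)\<^sup>2 = 1" by (simp_all add: c cos_squared_eq)
    then have "cos x = 1 \<or> cos x = - 1" "cos y = 1 \<or> cos y = - 1"
      by (auto simp: power2_eq_1_iff)
    then have "cosines c \<in> unstable_cosines" using s
      by (auto simp: c cosines_def unstable_cosines_def cos_diff)
    moreover obtain m n :: int where "x = of_int m * pi" "y = of_int n * pi"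
      using s by (auto simp: c sin_zero_iff_int2)
    ultimately show ?thesis by (auto simp: c)
  next
    assume s: "cos (fst c) = - 1/2 \<and> cos (snd c) = - 1/2 \<and> sin (snd c) = - sin (fst c)"
    then have "(sin x)\<^sup>2 = 3/4" using sin_squared_eq[of x] by (simp add: c power_divide)
    with s show ?thesis
      by (simp add: c cosines_def synchronised_cosines_def cos_diff power2_eq_square)
  qed
qed

lemma energy_critical:
  assumes "sin_field c = 0"
  shows "energy c \<in> {3, - 1, - 3/2}"
  using cosines_critical[OF assms]
  by (auto simp: energy_def cosines_def synchronised_cosines_def unstable_cosines_def)

text \<open>The cosines leave only the sign of \<open>sin x\<close> open, and this sign
  distinguishes the two states.\<close>

lemma synchronised_critical:
  assumes "sin_field c = 0" "cosines c = synchronised_cosines"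
  shows "c - (2 * pi / 3, 4 * pi / 3) \<in> period_lattice \<or> c - (4 * pi / 3, 2 * pi / 3) \<in> period_lattice"
proof -
  obtain x y where c: "c = (x, y)" by force
  have cs: "cos x = - 1/2" "cos y = - 1/2" using assms(2)
    by (auto simp: c cosines_def synchronised_cosines_def)
  then have s: "sin y = - sin x" using sin_field_eq_0_cases[OF assms(1)]
    by (auto simp: c)
  have "(sin x)\<^sup>2 = (sqrt 3 / 2)\<^sup>2" 
    using sin_squared_eq[of x] cs by (simp add: power_divide)
  then have sx: "sin x = sqrt 3 / 2 \<or> sin x = - (sqrt 3 / 2)" by (simp add: power2_eq_iff)
  have A: "cos (2 * pi / 3) = - 1/2" "sin (2 * pi / 3) = sqrt 3 / 2"
    using cos_120 sin_120 by (simp_all add: mult.commute)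
  have B_eq: "4 * pi / 3 = 2 * pi - 2 * pi / 3" by simp
  have B: "cos (4 * pi / 3) = - 1/2" "sin (4 * pi / 3) = - (sqrt 3 / 2)"
    unfolding B_eq cos_diff sin_diff A by simp_all
  consider "sin x = sin (2 * pi / 3) \<and> cos x = cos (2 * pi / 3) \<and> sin y = sin (4 * pi / 3) \<and> cos y = cos (4 * pi / 3)"
    | "sin x = sin (4 * pi / 3) \<and> cos x = cos (4 * pi / 3) \<and> sin y = sin (2 * pi / 3) \<and> cos y = cos (2 * pi / 3)"
    using sx cs s A B by fastforce
  then show ?thesis
  proof cases
    case 1
    then obtain m n :: int where "x = 2 * pi / 3 + 2 * pi * of_int m" "y = 4 * pi / 3 + 2 * pi * of_int n"
      using sin_cos_eq_iff by metis
    then have "c - (2 * pi / 3, 4 * pi / 3) = (2 * pi * of_int m, 2 * pi * of_int n)" by (simp add: c)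
    then show ?thesis unfolding period_lattice_def by blast
  next
    case 2
    then obtain m n :: int where "x = 4 * pi / 3 + 2 * pi * of_int m" "y = 2 * pi / 3 + 2 * pi * of_int n"
      using sin_cos_eq_iff by metis
    then have "c - (4 * pi / 3, 2 * pi / 3) = (2 * pi * of_int m, 2 * pi * of_int n)" by (simp add: c)
    then show ?thesis unfolding period_lattice_def by blast
  qed
qed

text \<open>On a closed period square with the open balls about all zeros removed, the norm of the
  field has a positive minimum; periodicity carries any point of the plane into the square and the
  zero found there back again.\<close>

lemma near_critical:
  assumes "r > 0"
  obtains \<sigma> where "\<sigma> > 0" "\<And>v. norm (sin_field v) < \<sigma> \<Longrightarrow> \<exists>c. sin_field c = 0 \<and> dist v c < r"
proof -
  define K where "K = cbox (0, 0) (2 * pi, 2 * pi) - (\<Union>c\<in>{c. sin_field c = 0}. ball c r)"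
  have "compact K" unfolding K_def
    by (intro compact_diff compact_cbox open_UN ballI open_ball)
  moreover have "continuous_on K (\<lambda>v. norm (sin_field v))"
    unfolding sin_field_def by (intro continuous_intros)
  moreover have pos: "norm (sin_field v) > 0" if "v \<in> K" for v
  proof -
    have "v \<in> ball v r" using assms by simp
    then have "sin_field v \<noteq> 0" using that unfolding K_def by blast
    then show ?thesis by simp
  qed
  ultimately obtain \<sigma> where \<sigma>: "\<sigma> > 0" "\<And>v. v \<in> K \<Longrightarrow> \<sigma> \<le> norm (sin_field v)"
  proof (cases "K = {}")
    case False
    then obtain m where "m \<in> K" "\<forall>v\<in>K. norm (sin_field m) \<le> norm (sin_field v)"
      using continuous_attains_inf[OF \<open>compact K\<close> False \<open>continuous_on K _\<close>] by blast
    then show ?thesis using that[of "norm (sin_field m)"] pos by blast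
  qed (use that[of 1] in simp)
  show thesis
  proof (rule that[OF \<sigma>(1)])
    fix v assume v: "norm (sin_field v) < \<sigma>"
    obtain l where l: "l \<in> period_lattice" "v + l \<in> {0..<2 * pi} \<times> {0..<2 * pi}"
      by (rule period_lattice_translate)
    have "v + l \<notin> K" using \<sigma>(2)[of "v + l"] v sin_field_periodic[OF l(1)] by auto
    moreover have "v + l \<in> cbox (0, 0) (2 * pi, 2 * pi)"
      using l(2) by (auto simp: cbox_Pair_eq mem_Times_iff)
    ultimately obtain c where c: "sin_field c = 0" "dist c (v + l) < r"
      unfolding K_def by auto
    have "sin_field (c - l) = 0"
      using sin_field_periodic[OF period_lattice_minus[OF l(1)], of c] c(1) by simp
    moreover have "dist v (c - l) < r"
      using c(2) by (simp add: dist_norm norm_minus_commute algebra_simps)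
    ultimately show "\<exists>c. sin_field c = 0 \<and> dist v c < r" by blast
  qed
qed

text \<open>The sequence may increase only near a level of \<open>V\<close>; it cannot return to a level once it has
  dropped below it, which excludes cycling.\<close>

lemma eventually_near_level:
  fixes w :: "nat \<Rightarrow> real"
  assumes V: "finite V" and gap: "\<And>v v'. v \<in> V \<Longrightarrow> v' \<in> V \<Longrightarrow> v < v' \<Longrightarrow> v + 2 * \<epsilon> < v'"
    and bdd: "\<And>k. b \<le> w k" and \<tau>: "\<tau> > 0"
    and far: "\<And>k. \<not> P k \<Longrightarrow> w (Suc k) \<le> w k - \<tau>"
    and near: "\<And>k. P k \<Longrightarrow> \<exists>v\<in>V. \<bar>w k - v\<bar> \<le> \<epsilon> \<and> w (Suc k) \<le> v + \<epsilon>"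
  shows "\<exists>v N. \<forall>k\<ge>N. \<bar>w k - v\<bar> \<le> \<epsilon>"
proof -
  have visit: "\<exists>k\<ge>N. P k" for N
  proof (rule ccontr)
    assume "\<not> (\<exists>k\<ge>N. P k)"
    then have "w (N + j) \<le> w N - of_nat j * \<tau>" for j
    proof (induction j)
      case (Suc j)
      then show ?case using far[of "N + j"] by (simp add: algebra_simps)
    qed simp
    moreover obtain j :: nat where "w N - b < of_nat j * \<tau>"
      using reals_Archimedean3[OF \<tau>] by blast
    ultimately show False using bdd[of "N + j"] by (smt (verit))
  qed
  define A where "A = {v \<in> V. \<exists>k. P k \<and> \<bar>w k - v\<bar> \<le> \<epsilon>}"
  have "finite A" using V by (simp add: A_def)
  obtain k where "P k" using visit by blast
  then have "A \<noteq> {}" using near[of k] unfolding A_def by blast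
  \<comment> \<open>The candidate is the lowest level met at a time with \<open>P\<close>. At a
    later such time the level met cannot be lower, and the gap condition keeps it from being higher
    while \<open>w\<close> is at most \<open>v + \<epsilon>\<close>.\<close>
  define v where "v = Min A"
  have v_min: "v \<le> v'" if "v' \<in> A" for v'
    using \<open>finite A\<close> that by (auto simp: v_def)
  have vA: "v \<in> A" using \<open>finite A\<close> \<open>A \<noteq> {}\<close> by (auto simp: v_def)
  then obtain N where N: "v \<in> V" "\<bar>w N - v\<bar> \<le> \<epsilon>" by (auto simp: A_def)
  have upper: "w k \<le> v + \<epsilon>" if "k \<ge> N" for k
    using that
  proof (induction k rule: dec_induct)
    case (step k)
    show ?case
    proof (cases "P k")
      case True
      then obtain v' where v': "v' \<in> V" "\<bar>w k - v'\<bar> \<le> \<epsilon>" "w (Suc k) \<le> v' + \<epsilon>"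
        using near by blast
      then have "v \<le> v'" using v_min True by (auto simp: A_def)
      moreover have "v' \<le> v + 2 * \<epsilon>" using v'(2) step.IH by linarith
      ultimately have "v = v'" using gap[of v v'] N(1) v'(1) by force
      then show ?thesis using v' by simp
    qed (use far[of k] step \<tau> in force)
  qed (use N in auto)
  \<comment> \<open>Below \<open>v - \<epsilon>\<close> the condition \<open>P\<close> would exhibit
    a level smaller than the minimum. So \<open>P\<close> would fail from then on and
    \<open>w\<close> would go on decreasing, against \<open>visit\<close>.\<close>
  have lower: "v - \<epsilon> \<le> w k" for k
  proof (rule ccontr)
    assume k: "\<not> v - \<epsilon> \<le> w k"
    have "w j < v - \<epsilon>" if "j \<ge> k" for j
      using that
    proof (induction j rule: dec_induct)
      case (step j)
      have "\<not> P j"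
      proof
        assume "P j"
        then obtain v' where "v' \<in> A" "\<bar>w j - v'\<bar> \<le> \<epsilon>"
          using near[of j] unfolding A_def by blast
        then show False using v_min[of v'] step.IH by linarith
      qed
      then show ?case using far[of j] step.IH \<tau> by linarith
    qed (use k in auto)
    moreover obtain j where "j \<ge> k" "P j" using visit by blast
    moreover obtain v' where "v' \<in> A" "\<bar>w j - v'\<bar> \<le> \<epsilon>"
      using near[of j] \<open>P j\<close> unfolding A_def by blast
    ultimately show False using v_min[of v'] by fastforce
  qed
  have "\<bar>w k - v\<bar> \<le> \<epsilon>" if "k \<ge> N" for k
    using upper[OF that] lower[of k] by linarith
  then show ?thesis by blast
qed

text \<open>Two scales are used. Gradients below \<open>\<sigma>\<close> put the energy within
  \<open>\<epsilon>\<close> of a critical level, so the energy is finally confined to a window of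
  width \<open>2 * \<epsilon>\<close>. A gradient of size at least the coarser threshold
  \<open>\<sigma>1\<close> would then cost more energy than this window contains, so the point is
  within \<open>r\<close> of a critical point.\<close>

lemma pseudo_orbit_near_critical:
  assumes a: "0 < a" "a < 1 / 3" and r: "0 < r"
  obtains \<eta> where "\<eta> > 0"
    "\<And>z :: nat \<Rightarrow> real \<times> real. (\<And>k. norm (z (Suc k) - (z k + a *\<^sub>R coupling (sin_field (z k)))) \<le> \<eta>) \<Longrightarrow>
       \<exists>N. \<forall>k\<ge>N. \<exists>c. sin_field c = 0 \<and> dist (z k) c < r"
proof -
  obtain \<sigma>1 where \<sigma>1: "\<sigma>1 > 0" "\<And>v. norm (sin_field v) < \<sigma>1 \<Longrightarrow> \<exists>c. sin_field c = 0 \<and> dist v c < r"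
    using near_critical[OF r] by blast
  \<comment> \<open>The bound \<open>1/8\<close> separates the levels 3, -1 and -3/2, whose smallest
    gap is 1/2; the other bound makes the window narrower than the drop
    \<open>a / 4 * \<sigma>1^2\<close>.\<close>
  define \<epsilon> where "\<epsilon> = min (1/8) (a * \<sigma>1\<^sup>2 / 16)"
  have \<epsilon>: "\<epsilon> > 0" "\<epsilon> \<le> 1/8" "2 * \<epsilon> < a / 4 * \<sigma>1\<^sup>2"
    using a \<sigma>1(1) by (auto simp: \<epsilon>_def min_def)
  obtain \<sigma> where \<sigma>: "\<sigma> > 0" "\<And>v. norm (sin_field v) < \<sigma> \<Longrightarrow> \<exists>c. sin_field c = 0 \<and> dist v c < \<epsilon> / 8"
    using near_critical[of "\<epsilon> / 8"] \<epsilon> by auto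
  \<comment> \<open>The first bound lets the gradient gain dominate the error as soon as the
    gradient reaches \<open>\<sigma>\<close> or \<open>\<sigma>1\<close>. The others limit the rise
    of the energy where the gradient is below \<open>\<sigma>\<close>: it is at most
    \<open>\<eta> * (\<sigma> + 2)\<close>, hence at most \<open>\<epsilon> / 2\<close>.\<close>
  define \<eta> where "\<eta> = min (a * min \<sigma> \<sigma>1 / 16) (min 1 (\<epsilon> / (2 * (\<sigma> + 2))))"
  have \<eta>: "\<eta> > 0" "\<eta> \<le> a * \<sigma> / 16" "\<eta> \<le> a * \<sigma>1 / 16" "\<eta> \<le> 1" "\<eta> \<le> \<epsilon> / (2 * (\<sigma> + 2))"
  proof -
    have "a * min \<sigma> \<sigma>1 \<le> a * \<sigma>" "a * min \<sigma> \<sigma>1 \<le> a * \<sigma>1"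
      using a by (auto intro!: mult_left_mono)
    moreover have "\<eta> \<le> a * min \<sigma> \<sigma>1 / 16" unfolding \<eta>_def by (rule min.cobounded1)
    ultimately show "\<eta> \<le> a * \<sigma> / 16" "\<eta> \<le> a * \<sigma>1 / 16" by linarith+
  qed (use a \<sigma>(1) \<sigma>1(1) \<epsilon>(1) in \<open>auto simp: \<eta>_def\<close>)
  have \<eta>': "\<eta> * (\<sigma> + 2) \<le> \<epsilon> / 2"
    using \<eta>(5) \<sigma>(1) by (simp add: pos_le_divide_eq algebra_simps)
  show thesis
  proof (rule that[OF \<eta>(1)])
    fix z :: "nat \<Rightarrow> real \<times> real"
    assume z: "\<And>k. norm (z (Suc k) - (z k + a *\<^sub>R coupling (sin_field (z k)))) \<le> \<eta>"
    let ?n = "\<lambda>k. norm (sin_field (z k))"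
    have descent: "energy (z (Suc k)) \<le> energy (z k) - a / 2 * (?n k)\<^sup>2 + ?n k * \<eta> + 2 * \<eta>\<^sup>2" for k
    proof -
      define p where "p = z (Suc k) - (z k + a *\<^sub>R coupling (sin_field (z k)))"
      have p: "norm p \<le> \<eta>" using z by (simp add: p_def)
      then have "?n k * norm p \<le> ?n k * \<eta>" "(norm p)\<^sup>2 \<le> \<eta>\<^sup>2"
        by (auto intro: mult_left_mono power_mono)
      moreover have "energy (z (Suc k)) \<le> energy (z k) - a / 2 * (?n k)\<^sup>2 + ?n k * norm p + 2 * (norm p)\<^sup>2"
        using energy_descent[OF a, of "z k" p] by (simp add: p_def)
      ultimately show ?thesis by linarith
    qed
    have drop: "energy (z (Suc k)) \<le> energy (z k) - a / 4 * s\<^sup>2"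
      if s: "s > 0" "\<eta> \<le> a * s / 16" "s \<le> ?n k" for k s
    proof -
      let ?m = "?n k"
      have \<eta>_le: "\<eta> \<le> a * ?m / 16" using s a mult_left_mono[OF s(3), of a] by linarith
      then have "?m * \<eta> \<le> ?m * (a * ?m / 16)" "\<eta> * \<eta> \<le> (a * ?m / 16) * (a * ?m / 16)"
        by (intro mult_left_mono mult_mono \<eta>_le;
            use \<eta>(1) \<eta>_le norm_ge_zero[of "sin_field (z k)"] in linarith)+
      moreover have "(a * ?m / 16) * (a * ?m / 16) \<le> a * ?m\<^sup>2 / 256"
      proof -
        have "a * (a * ?m\<^sup>2) \<le> 1 * (a * ?m\<^sup>2)" by (rule mult_right_mono) (use a in auto)
        then show ?thesis by (simp add: power2_eq_square mult_ac)
      qed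
      moreover have "?m * (a * ?m / 16) = a * ?m\<^sup>2 / 16" by (simp add: power2_eq_square)
      moreover have "a * s\<^sup>2 \<le> a * ?m\<^sup>2" using a s by (intro mult_left_mono power_mono) auto
      moreover have "0 \<le> a * ?m\<^sup>2" using a by simp
      moreover have "\<eta>\<^sup>2 = \<eta> * \<eta>" by (rule power2_eq_square)
      ultimately show ?thesis using descent[of k] by (simp only: times_divide_eq_left)
    qed
    have "\<exists>v N. \<forall>k\<ge>N. \<bar>energy (z k) - v\<bar> \<le> \<epsilon>"
    proof (rule eventually_near_level[where V = "{3, - 1, - 3/2}" and P = "\<lambda>k. ?n k < \<sigma>"
          and \<tau> = "a / 4 * \<sigma>\<^sup>2" and b = "- 3"])
      show "0 < a / 4 * \<sigma>\<^sup>2" using a \<sigma> by simp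
      show "energy (z (Suc k)) \<le> energy (z k) - a / 4 * \<sigma>\<^sup>2" if "\<not> ?n k < \<sigma>" for k
        using drop[of \<sigma> k] that \<sigma>(1) \<eta>(2) by simp
      show "\<exists>v\<in>{3, - 1, - 3/2}. \<bar>energy (z k) - v\<bar> \<le> \<epsilon> \<and> energy (z (Suc k)) \<le> v + \<epsilon>" if n: "?n k < \<sigma>" for k
      proof -
        obtain c where c: "sin_field c = 0" "dist (z k) c < \<epsilon> / 8" using \<sigma>(2)[OF n] by blast
        have near: "\<bar>energy (z k) - energy c\<bar> \<le> \<epsilon> / 2"
          using energy_lipschitz[of "z k" c] c(2) by (simp add: dist_norm)
        have "?n k * \<eta> \<le> \<sigma> * \<eta>" "\<eta>\<^sup>2 \<le> \<eta>"
          using n \<eta> by (auto intro!: mult_right_mono simp: power2_eq_square mult_left_le_one_le)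
        moreover have "0 \<le> a / 2 * (?n k)\<^sup>2" using a by simp
        ultimately have "energy (z (Suc k)) \<le> energy (z k) + \<epsilon> / 2"
          using descent[of k] \<eta>' by (simp add: algebra_simps)
        then have "\<bar>energy (z k) - energy c\<bar> \<le> \<epsilon> \<and> energy (z (Suc k)) \<le> energy c + \<epsilon>"
          using near \<epsilon>(1) by linarith
        then show ?thesis using energy_critical[OF c(1)] by blast
      qed
    qed (use energy_ge \<epsilon>(2) in auto)
    then obtain v N where N: "\<And>k. k \<ge> N \<Longrightarrow> \<bar>energy (z k) - v\<bar> \<le> \<epsilon>" by blast
    have "?n k < \<sigma>1" if "k \<ge> N" for k
    proof (rule ccontr)
      assume "\<not> ?n k < \<sigma>1"
      then have "energy (z (Suc k)) \<le> energy (z k) - a / 4 * \<sigma>1\<^sup>2"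
        using drop[of \<sigma>1 k] \<sigma>1(1) \<eta>(3) by simp
      then show False using N[of k] N[of "Suc k"] that \<epsilon>(3) by simp
    qed
    then show "\<exists>N. \<forall>k\<ge>N. \<exists>c. sin_field c = 0 \<and> dist (z k) c < r" using \<sigma>1(2) by blast
  qed
qed

subsection \<open>Growth near unstable critical points\<close>

text \<open>For \<open>k = cosines c\<close> this is the derivative at \<open>c\<close> of the
  unperturbed lift.\<close>

definition tangent :: "real \<Rightarrow> real \<times> real \<times> real \<Rightarrow> real \<times> real \<Rightarrow> real \<times> real" where
  "tangent a k d = d + a *\<^sub>R coupling (linear_field k d)"

text \<open>At a minimum the Hessian of \<open>energy\<close> is 3/2 times the inverse coupling
  matrix, so the coupling cancels and the derivative is a homothety. This is why contraction holds
  in the Euclidean norm.\<close>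

lemma tangent_synchronised: "tangent a synchronised_cosines d = (1 - 3 / 2 * a) *\<^sub>R d"
  by (cases d) (simp add: tangent_def coupling_def linear_field_def synchronised_cosines_def algebra_simps)

text \<open>At a maximum the tangent map is multiplication by \<open>1 + 3 * a\<close>; at a saddle
  its eigenvalues are \<open>1 + a\<close> and \<open>1 - 3 * a\<close>, with \<open>hess\<close>
  diagonal in eigen-coordinates, positive along the first and negative along the second. The form
  thus grows by \<open>(1 + a)^2\<close> on the expanding line; asking only for the factor
  \<open>1 + a\<close> leaves the margin \<open>a / 4 * (norm d)^2\<close>, which will absorb the
  nonlinear error.\<close>

lemma hess_growth_linear:
  assumes a: "0 < a" "a < 1 / 3" and k: "k \<in> unstable_cosines"
  shows "hess k (tangent a k d) \<ge> (1 + a) * hess k d + a / 4 * (norm d)\<^sup>2"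
proof -
  obtain x y where d: "d = (x, y)" by force
  have aa: "a * a \<le> a / 3" using mult_left_mono[of a "1/3" a] a by simp
  have [simp]: "(norm d)\<^sup>2 = x\<^sup>2 + y\<^sup>2" by (simp add: norm_prod_sq d)
  \<comment> \<open>Converts the margin from eigen-coordinates into the Euclidean norm, for the two
    saddle types whose eigen-coordinates are \<open>u\<close> and \<open>s\<close> as defined in
    their cases.\<close>
  have diag: "a / 2 * u\<^sup>2 + (7 * a - 9 * (a * a)) / 2 * s\<^sup>2 \<ge> a / 4 * (u\<^sup>2 + ((u - s) / 2)\<^sup>2)" for u s :: real
  proof -
    have "a / 4 * (u\<^sup>2 + ((u - s) / 2)\<^sup>2) \<le> a / 4 * (u\<^sup>2 + (u\<^sup>2 + s\<^sup>2) / 2)"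
    proof (intro mult_left_mono add_left_mono)
      show "((u - s) / 2)\<^sup>2 \<le> (u\<^sup>2 + s\<^sup>2) / 2"
        using zero_le_power2[of "u + s"] by (simp add: power2_eq_square field_simps)
    qed (use a in auto)
    moreover have "(7 * a - 9 * (a * a)) / 2 * s\<^sup>2 \<ge> 2 * a * s\<^sup>2"
      using aa by (intro mult_right_mono) auto
    moreover have "a * s\<^sup>2 \<ge> 0" "a * u\<^sup>2 \<ge> 0" using a by auto
    moreover have "a / 4 * (u\<^sup>2 + (u\<^sup>2 + s\<^sup>2) / 2) = 3 / 8 * (a * u\<^sup>2) + 1 / 8 * (a * s\<^sup>2)"
      by (simp add: field_simps)
    moreover have "2 * a * s\<^sup>2 = 2 * (a * s\<^sup>2)" "a / 2 * u\<^sup>2 = a * u\<^sup>2 / 2" by simp_all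
    ultimately show ?thesis by linarith
  qed
  from k consider "k = (1, 1, 1)" | "k = (- 1, - 1, 1)" | "k = (1, - 1, - 1)" | "k = (- 1, 1, - 1)"
    by (auto simp: unstable_cosines_def)
  then show ?thesis
  proof cases
    case 1
    define q where "q = x\<^sup>2 + y\<^sup>2 + (x - y)\<^sup>2"
    have "hess k (tangent a k d) = (1 + 6 * a + 9 * (a * a)) * q" "hess k d = q"
      by (simp_all add: 1 d q_def hess_def tangent_def coupling_def linear_field_def power2_eq_square algebra_simps)
    moreover have "a * q \<ge> a * (x\<^sup>2 + y\<^sup>2)" "q \<ge> 0" "a * a * q \<ge> 0" "0 \<le> a * (x\<^sup>2 + y\<^sup>2)"
      using a by (auto simp: q_def intro!: mult_left_mono)
    ultimately show ?thesis by (simp add: algebra_simps)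
  next
    case 2
    have "hess k (tangent a k d) - (1 + a) * hess k d
       = 4 * (a * (1 - a)) * (x\<^sup>2 + y\<^sup>2) + (a * (3 - 5 * a)) * (2 * x * y)"
      by (simp add: 2 d hess_def tangent_def coupling_def linear_field_def power2_eq_square algebra_simps)
    moreover have "(a * (3 - 5 * a)) * (2 * x * y) \<ge> (a * (3 - 5 * a)) * (- (x\<^sup>2 + y\<^sup>2))"
      using a zero_le_power2[of "x + y"] by (intro mult_left_mono) (auto simp: power2_eq_square algebra_simps)
    moreover have "a * (x\<^sup>2 + y\<^sup>2) \<ge> 0" "a * a * (x\<^sup>2 + y\<^sup>2) \<ge> 0" using a by auto
    ultimately show ?thesis by (simp add: algebra_simps)
  next
    case 3
    \<comment> \<open>Eigen-coordinates: the tangent map multiplies \<open>u\<close> by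
      \<open>1 + a\<close> and \<open>s\<close> by \<open>1 - 3 * a\<close>, and the form is
      \<open>(u^2 - s^2) / 2\<close>. The remaining case exchanges the roles of \<open>x\<close> and
      \<open>y\<close>.\<close>
    define u s where "u = x" and "s = x - 2 * y"
    then have xy: "x = u" "y = (u - s) / 2" by auto
    have "hess k (tangent a k d) - (1 + a) * hess k d
       = a * (1 + a) / 2 * u\<^sup>2 + (7 * a - 9 * (a * a)) / 2 * s\<^sup>2"
      by (simp add: 3 d xy hess_def tangent_def coupling_def linear_field_def power2_eq_square field_simps)
    moreover have "a * (1 + a) / 2 * u\<^sup>2 \<ge> a / 2 * u\<^sup>2" using a by (intro mult_right_mono) (auto simp: algebra_simps)
    moreover have "a / 4 * (norm d)\<^sup>2 = a / 4 * (u\<^sup>2 + ((u - s) / 2)\<^sup>2)" by (simp add: xy)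
    ultimately show ?thesis using diag[of u s] by linarith
  next
    case 4
    define u s where "u = y" and "s = y - 2 * x"
    then have xy: "y = u" "x = (u - s) / 2" by auto
    have "hess k (tangent a k d) - (1 + a) * hess k d
       = a * (1 + a) / 2 * u\<^sup>2 + (7 * a - 9 * (a * a)) / 2 * s\<^sup>2"
      by (simp add: 4 d xy hess_def tangent_def coupling_def linear_field_def power2_eq_square field_simps)
    moreover have "a * (1 + a) / 2 * u\<^sup>2 \<ge> a / 2 * u\<^sup>2" using a by (intro mult_right_mono) (auto simp: algebra_simps)
    moreover have "a / 4 * (norm d)\<^sup>2 = a / 4 * (u\<^sup>2 + ((u - s) / 2)\<^sup>2)" by (simp add: xy)
    ultimately show ?thesis using diag[of u s] by linarith
  qed
qed

lemma unstable_cosines_abs_le: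
  assumes "(k1, k2, k3) \<in> unstable_cosines"
  shows "\<bar>k1\<bar> = 1" "\<bar>k2\<bar> = 1" "\<bar>k3\<bar> = 1"
  using assms by (auto simp: unstable_cosines_def)

lemma hess_perturb:
  assumes k: "k \<in> unstable_cosines"
  shows "\<bar>hess k (w + p) - hess k w\<bar> \<le> 10 * (norm w * norm p) + 5 * (norm p)\<^sup>2"
proof -
  obtain k1 k2 k3 where k': "k = (k1, k2, k3)" by (cases k) auto
  have abs1: "\<bar>c * t\<bar> \<le> T" if "\<bar>c\<bar> = 1" "\<bar>t\<bar> \<le> T" for c t T :: real
    using that by (simp add: abs_mult)
  let ?W = "norm w" and ?P = "norm p"
  have sq: "\<bar>(t + s)\<^sup>2 - t\<^sup>2\<bar> \<le> 2 * (A * B) + B\<^sup>2" if "\<bar>t\<bar> \<le> A" "\<bar>s\<bar> \<le> B" for t s A B :: real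
  proof -
    have "\<bar>t\<bar> * \<bar>s\<bar> \<le> A * B" by (rule mult_mono) (use that in auto)
    moreover have "\<bar>s\<bar>\<^sup>2 \<le> B\<^sup>2" using that by (intro power_mono) auto
    moreover have "(t + s)\<^sup>2 - t\<^sup>2 = 2 * (t * s) + s\<^sup>2" by (simp add: power2_eq_square algebra_simps)
    then have "\<bar>(t + s)\<^sup>2 - t\<^sup>2\<bar> \<le> 2 * (\<bar>t\<bar> * \<bar>s\<bar>) + \<bar>s\<bar>\<^sup>2"
      using abs_triangle_ineq[of "2 * (t * s)" "s\<^sup>2"] by (simp add: abs_mult)
    ultimately show ?thesis by linarith
  qed
  define A where "A = (fst w + fst p)\<^sup>2 - (fst w)\<^sup>2"
  define B where "B = (snd w + snd p)\<^sup>2 - (snd w)\<^sup>2"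
  define C where "C = ((fst w - snd w) + (fst p - snd p))\<^sup>2 - (fst w - snd w)\<^sup>2"
  have diff: "\<bar>fst v - snd v\<bar> \<le> sqrt 2 * norm v" for v :: "real \<times> real"
  proof -
    have "\<bar>fst v - snd v\<bar>\<^sup>2 = (sqrt 2 * norm v)\<^sup>2 - (fst v + snd v)\<^sup>2"
      by (simp add: power_mult_distrib norm_prod_sq) (simp add: power2_eq_square algebra_simps)
    then have "\<bar>fst v - snd v\<bar>\<^sup>2 \<le> (sqrt 2 * norm v)\<^sup>2" by simp
    then show ?thesis by (rule power2_le_imp_le) simp
  qed
  have "\<bar>A\<bar> \<le> 2 * (?W * ?P) + ?P\<^sup>2" "\<bar>B\<bar> \<le> 2 * (?W * ?P) + ?P\<^sup>2"
    unfolding A_def B_def by (intro sq abs_fst_le_norm abs_snd_le_norm)+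
  moreover have "\<bar>C\<bar> \<le> 2 * ((sqrt 2 * ?W) * (sqrt 2 * ?P)) + (sqrt 2 * ?P)\<^sup>2"
    unfolding C_def by (intro sq diff)
  moreover have "(sqrt 2 * ?W) * (sqrt 2 * ?P) = 2 * (?W * ?P)" "(sqrt 2 * ?P)\<^sup>2 = 2 * ?P\<^sup>2"
    by (simp_all add: power_mult_distrib)
  ultimately have "\<bar>k1 * A\<bar> \<le> 2 * (?W * ?P) + ?P\<^sup>2" "\<bar>k2 * B\<bar> \<le> 2 * (?W * ?P) + ?P\<^sup>2"
    "\<bar>k3 * C\<bar> \<le> 4 * (?W * ?P) + 2 * ?P\<^sup>2"
    using unstable_cosines_abs_le[OF k[unfolded k']] by (auto intro!: abs1)
  moreover have "hess k (w + p) - hess k w = k1 * A + k2 * B + k3 * C"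
    by (simp add: k' hess_def A_def B_def C_def algebra_simps)
  ultimately show ?thesis by (simp only:)
qed

text \<open>\<open>13 = 1 + 6 * 6 / 3\<close>: a factor 6 from the linear field, 6 from the
  coupling, and \<open>a < 1/3\<close>.\<close>

lemma norm_tangent_le:
  assumes "0 < a" "a < 1 / 3" "k \<in> unstable_cosines"
  shows "norm (tangent a k d) \<le> 13 * norm d"
proof -
  obtain k1 k2 k3 where k: "k = (k1, k2, k3)" by (cases k) auto
  note b = unstable_cosines_abs_le[OF assms(3)[unfolded k]]
  have "norm (linear_field k d) \<le> \<bar>k1 * fst d + k3 * (fst d - snd d)\<bar> + \<bar>k2 * snd d - k3 * (fst d - snd d)\<bar>"
    using norm_prod_le_abs[of "linear_field k d"] by (simp add: linear_field_def k)
  also have "\<dots> \<le> 3 * \<bar>fst d\<bar> + 3 * \<bar>snd d\<bar>"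
  proof -
    have "k1 = 1 \<or> k1 = - 1" "k2 = 1 \<or> k2 = - 1" "k3 = 1 \<or> k3 = - 1" using b by auto
    then show ?thesis by (elim disjE; simp only: mult_1 mult_minus_left; linarith)
  qed
  also have "\<dots> \<le> 6 * norm d" using abs_fst_le_norm[of d] abs_snd_le_norm[of d] by linarith
  finally have lin: "norm (linear_field k d) \<le> 6 * norm d" .
  have "norm (tangent a k d) \<le> norm d + a * norm (coupling (linear_field k d))"
    using norm_triangle_ineq[of d "a *\<^sub>R coupling (linear_field k d)"] assms by (simp add: tangent_def)
  also have "\<dots> \<le> norm d + 1/3 * (6 * (6 * norm d))"
    using norm_coupling_le[of "linear_field k d"] lin assms by (intro add_left_mono mult_mono) auto
  finally show ?thesis 
    by simp
qed

text \<open>The tolerance \<open>a / 600\<close> is fitted to the margin of the linear estimate: the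
  form changes by at most \<open>(10 * 13 + 5) / 600 * a * (norm d)^2\<close>, which is less than
  \<open>a / 4 * (norm d)^2\<close>.\<close>

lemma hess_growth:
  assumes a: "0 < a" "a < 1 / 3" and k: "k \<in> unstable_cosines"
    and p: "norm p \<le> a / 600 * norm d"
  shows "hess k (tangent a k d + p) \<ge> (1 + a) * hess k d"
proof -
  let ?n = "norm d"
  have "norm (tangent a k d) * norm p \<le> (13 * ?n) * (a / 600 * ?n)"
    by (intro mult_mono norm_tangent_le[OF a k] p) auto
  moreover have "(norm p)\<^sup>2 \<le> (a / 600 * ?n)\<^sup>2" by (intro power_mono p) auto
  moreover have "(13 * ?n) * (a / 600 * ?n) = 13 / 600 * (a * ?n\<^sup>2)" by (simp add: power2_eq_square)
  moreover have "(a / 600 * ?n)\<^sup>2 \<le> 1 / 600 * (a * ?n\<^sup>2)"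
  proof -
    have "a / 600 * (a * ?n\<^sup>2) \<le> 1 * (a * ?n\<^sup>2)" by (intro mult_right_mono) (use a in auto)
    then show ?thesis by (simp add: power2_eq_square mult_ac)
  qed
  moreover have "0 \<le> a * ?n\<^sup>2" using a by simp
  ultimately show ?thesis
    using hess_growth_linear[OF a k, of d] hess_perturb[OF k, of "tangent a k d" p]
    by (simp only: times_divide_eq_left mult_1)
qed

text \<open>The cone projects to a line with Lipschitz inverse. At a maximum the cone is trivial. At
  a saddle \<open>hess k\<close> is -2 times a product of two linear forms; in the cone these do not
  have opposite signs, so their absolute values add up to that of their sum, which is the
  contracting eigen-coordinate.\<close>

lemma hess_nonpos:
  assumes "k \<in> unstable_cosines"
  obtains \<alpha> \<beta> where "\<And>d. hess k d \<le> 0 \<Longrightarrow> norm d \<le> 2 * \<bar>\<alpha> * fst d + \<beta> * snd d\<bar>"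
proof -
  have sum_eq: "\<bar>s\<bar> + \<bar>t\<bar> = \<bar>s + t\<bar>" if "0 \<le> s * t" for s t :: real
    using that by (auto simp: zero_le_mult_iff)
  from assms consider "k = (1, 1, 1)" | "k = (- 1, - 1, 1)" | "k = (1, - 1, - 1)" | "k = (- 1, 1, - 1)"
    by (auto simp: unstable_cosines_def)
  then show thesis
  proof cases
    case 1
    have "d = 0" if "hess k d \<le> 0" for d
    proof -
      have "(norm d)\<^sup>2 + (fst d - snd d)\<^sup>2 \<le> 0" using that by (simp add: 1 hess_def norm_prod_sq)
      then show ?thesis by (simp add: sum_power2_le_zero_iff)
    qed
    then show thesis by (intro that[of 0 0]) auto
  next
    case 2
    have "norm d \<le> 2 * \<bar>1 * fst d + 1 * snd d\<bar>" if "hess k d \<le> 0" for d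
    proof -
      have "0 \<le> fst d * snd d" using that by (simp add: 2 hess_def power2_eq_square algebra_simps)
      from sum_eq[OF this] have "norm d \<le> \<bar>fst d + snd d\<bar>"
        using norm_prod_le_abs[of d] by simp
      also have "\<dots> \<le> 2 * \<bar>fst d + snd d\<bar>" by simp
      finally show ?thesis by simp
    qed
    then show thesis by (rule that)
  next
    case 3
    have "norm d \<le> 2 * \<bar>1 * fst d + (- 2) * snd d\<bar>" if "hess k d \<le> 0" for d
    proof -
      have nonneg: "0 \<le> (fst d - snd d) * (- snd d)" using that by (simp add: 3 hess_def power2_eq_square algebra_simps)
      have eq: "1 * fst d + - 2 * snd d = (fst d - snd d) + - snd d" by simp
      have "norm d \<le> 2 * (\<bar>fst d - snd d\<bar> + \<bar>- snd d\<bar>)"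
        using norm_prod_le_abs[of d] abs_triangle_ineq[of "fst d - snd d" "snd d"] by (smt (verit))
      then show ?thesis unfolding eq sum_eq[OF nonneg] .
    qed
    then show thesis by (rule that)
  next
    case 4
    have "norm d \<le> 2 * \<bar>(- 2) * fst d + 1 * snd d\<bar>" if "hess k d \<le> 0" for d
    proof -
      have nonneg: "0 \<le> (snd d - fst d) * (- fst d)" using that by (simp add: 4 hess_def power2_eq_square algebra_simps)
      have eq: "- 2 * fst d + 1 * snd d = (snd d - fst d) + - fst d" by simp
      have "norm d \<le> 2 * (\<bar>snd d - fst d\<bar> + \<bar>- fst d\<bar>)"
        using norm_prod_le_abs[of d] abs_triangle_ineq[of "snd d - fst d" "fst d"] by (smt (verit))
      then show ?thesis unfolding eq sum_eq[OF nonneg] .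
    qed
    then show thesis by (rule that)
  qed
qed

text \<open>The inverse of \<open>h\<close> on its image is Lipschitz and such maps preserve null
  sets. It is applied to a projection, for the trapped points, and to the lift, for
  preimages.\<close>

lemma negligible_if_expanding_into:
  fixes h :: "'a::euclidean_space \<Rightarrow> 'a"
  assumes N: "negligible N" "h ` S \<subseteq> N"
    and h: "\<And>u v. u \<in> S \<Longrightarrow> v \<in> S \<Longrightarrow> norm (u - v) \<le> C * norm (h u - h v)"
  shows "negligible S"
proof -
  have inj: "inj_on h S"
  proof (rule inj_onI)
    fix u v assume "u \<in> S" "v \<in> S" "h u = h v"
    then show "u = v" using h[of u v] by simp
  qed
  have "negligible (inv_into S h ` (h ` S))"
  proof (rule negligible_locally_Lipschitz_image)
    show "negligible (h ` S)" using N negligible_subset by blast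
    show "\<exists>T B. open T \<and> x \<in> T \<and> (\<forall>y\<in>h ` S \<inter> T. norm (inv_into S h y - inv_into S h x) \<le> B * norm (y - x))"
      if "x \<in> h ` S" for x
      using that h inj by (intro exI[of _ UNIV] exI[of _ C]) auto
  qed simp
  then show ?thesis by (simp add: image_comp inj)
qed

subsection \<open>The perturbed lift\<close>

text \<open>\<open>r_small\<close> brings the linearisation error in a ball of radius
  \<open>r\<close> below the tolerance \<open>a / 600\<close> of \<open>hess_growth\<close>;
  \<open>\<eta>_le\<close> keeps the displacement of a sink within half of the inward push
  \<open>a * r\<close> of the contraction; \<open>\<eta>_less\<close> preserves strong
  monotonicity.\<close>

locale perturbed_lift =
  fixes a \<eta> r :: real and e :: "real \<times> real \<Rightarrow> real \<times> real"
  assumes a_pos: "0 < a" and a_less: "a < 1 / 3"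
    and r_pos: "0 < r" and r_small: "r \<le> a / 40000"
    and \<eta>_le: "\<eta> \<le> a * r / 2" and \<eta>_less: "6 * \<eta> \<le> (1 - 3 * a)"
    and e_bound: "norm (e v) \<le> \<eta>"
    and e_lipschitz: "norm (e u - e v) \<le> \<eta> * norm (u - v)"
begin

definition lift_map :: "real \<times> real \<Rightarrow> real \<times> real" where
  "lift_map v = v + a *\<^sub>R coupling (sin_field v) + e v"

lemma \<eta>_nonneg: "0 \<le> \<eta>"
  using e_bound[of 0] norm_ge_zero order_trans by blast

lemma \<eta>_small: "20 * r + \<eta> \<le> a / 600"
proof -
  have "a * r \<le> r" using a_pos a_less r_pos by simp
  then show ?thesis using \<eta>_le r_small a_pos by linarith
qed

lemma lift_map_lower_bound: "(1 - 3 * a) * norm (u - v) \<le> 6 * norm (lift_map u - lift_map v)"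
  unfolding lift_map_def by (rule sin_field_monotone[OF a_pos a_less e_lipschitz \<eta>_less])

lemma lift_map_linearization:
  assumes "u \<in> cball c r" "v \<in> cball c r"
  shows "norm (lift_map u - lift_map v - tangent a (cosines c) (u - v)) \<le> a / 600 * norm (u - v)"
proof -
  define s where "s = sin_field u - sin_field v - linear_field (cosines c) (u - v)"
  have "lift_map u - lift_map v - tangent a (cosines c) (u - v) = a *\<^sub>R coupling s + (e u - e v)"
    by (simp add: lift_map_def tangent_def s_def coupling_diff scaleR_diff_right)
  then have "norm (lift_map u - lift_map v - tangent a (cosines c) (u - v)) \<le> norm (a *\<^sub>R coupling s) + norm (e u - e v)"
    by (simp only: norm_triangle_ineq)
  \<comment> \<open>The constant 20 is \<open>6 * 10 / 3\<close>: coupling, linearisation of the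
    field, and \<open>a < 1/3\<close>.\<close>
  moreover have "norm (a *\<^sub>R coupling s) \<le> 20 * r * norm (u - v)"
  proof -
    have "norm (coupling s) \<le> 6 * norm s" by (rule norm_coupling_le)
    moreover have "norm s \<le> 10 * r * norm (u - v)"
      unfolding s_def by (rule sin_field_linearization[OF assms])
    ultimately have "norm (coupling s) \<le> 60 * r * norm (u - v)" by linarith
    then have "a * norm (coupling s) \<le> 1/3 * (60 * r * norm (u - v))"
      using a_pos a_less by (intro mult_mono) auto
    then show ?thesis using a_pos by simp
  qed
  moreover have "(20 * r + \<eta>) * norm (u - v) \<le> a / 600 * norm (u - v)"
    by (intro mult_right_mono \<eta>_small) auto
  ultimately show ?thesis using e_lipschitz[of u v] by (simp add: distrib_right)
qed

lemma sink_contraction: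
  assumes "cosines c = synchronised_cosines" "u \<in> cball c r" "v \<in> cball c r"
  shows "norm (lift_map u - lift_map v) \<le> (1 - a) * norm (u - v)"
proof -
  have "norm (lift_map u - lift_map v) \<le> norm (lift_map u - lift_map v - tangent a (cosines c) (u - v))
      + norm (tangent a (cosines c) (u - v))"
    by (metis diff_add_cancel norm_triangle_ineq)
  moreover have "norm (tangent a (cosines c) (u - v)) = (1 - 3 / 2 * a) * norm (u - v)"
    using a_pos a_less by (simp add: assms(1) tangent_synchronised)
  moreover have "a * norm (u - v) \<ge> 0" using a_pos by simp
  ultimately show ?thesis using lift_map_linearization[OF assms(2,3)] by (simp add: algebra_simps)
qed

text \<open>Contraction pulls the ball in by \<open>a * r\<close>, while the perturbation moves its
  centre by at most \<open>a * r / 2\<close>.\<close>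

lemma sink_invariant:
  assumes c: "sin_field c = 0" "cosines c = synchronised_cosines" and u: "u \<in> cball c r"
  shows "lift_map u \<in> cball c r"
proof -
  have "norm (lift_map u - lift_map c) \<le> (1 - a) * norm (u - c)"
    using c u r_pos by (intro sink_contraction) auto
  also have "\<dots> \<le> (1 - a) * r"
    using u a_pos a_less by (intro mult_left_mono) (auto simp: dist_norm norm_minus_commute)
  finally have "norm (lift_map u - lift_map c) \<le> r - a * r" by (simp add: algebra_simps)
  moreover have "lift_map c - c = e c" using c by (simp add: lift_map_def coupling_def zero_prod_def[symmetric])
  then have "norm (lift_map c - c) \<le> a * r / 2" using e_bound[of c] \<eta>_le by simp
  moreover have "norm (lift_map u - c) \<le> norm (lift_map u - lift_map c) + norm (lift_map c - c)"
    using norm_triangle_ineq[of "lift_map u - lift_map c" "lift_map c - c"] by simp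
  moreover have "a * r \<ge> 0" using a_pos r_pos by simp
  ultimately show ?thesis by (simp add: dist_norm norm_minus_commute)
qed

text \<open>Banach's theorem gives the point, and comparing it with the image of \<open>c\<close>
  improves its distance to \<open>r / 2\<close>. The improved radius keeps the ball of radius
  \<open>r / 2\<close> about the fixed point inside the region of contraction.\<close>

lemma sink_fixed_point:
  assumes c: "sin_field c = 0" "cosines c = synchronised_cosines"
  obtains x where "dist c x \<le> r / 2" "lift_map x = x"
proof -
  have "\<exists>!x\<in>cball c r. lift_map x = x"
  proof (rule Banach_fix)
    show "lift_map ` cball c r \<subseteq> cball c r" using sink_invariant[OF c] by auto
    show "dist (lift_map x) (lift_map y) \<le> (1 - a) * dist x y" if "x \<in> cball c r" "y \<in> cball c r" for x y
      using sink_contraction[OF c(2) that] by (simp add: dist_norm)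
  qed (use a_pos a_less r_pos in \<open>auto simp: complete_eq_closed\<close>)
  then obtain x where x: "x \<in> cball c r" "lift_map x = x" by blast
  have "norm (x - lift_map c) \<le> (1 - a) * norm (x - c)"
    using sink_contraction[OF c(2) x(1), of c] x(2) r_pos by simp
  moreover have "lift_map c - c = e c" using c by (simp add: lift_map_def coupling_def zero_prod_def[symmetric])
  then have "norm (lift_map c - c) \<le> a * (r / 2)" using e_bound[of c] \<eta>_le by simp
  moreover have "norm (x - c) \<le> norm (x - lift_map c) + norm (lift_map c - c)"
    using norm_triangle_ineq[of "x - lift_map c" "lift_map c - c"] by simp
  ultimately have "a * norm (x - c) \<le> a * (r / 2)" by (simp add: algebra_simps)
  then have "dist c x \<le> r / 2" using a_pos by (simp add: dist_norm norm_minus_commute)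
  then show thesis using that x by blast
qed

lemma sink_orbit:
  assumes c: "sin_field c = 0" "cosines c = synchronised_cosines"
    and x: "x \<in> cball c r" "lift_map x = x" and u: "u \<in> cball c r"
  shows "(lift_map ^^ n) u \<in> cball c r \<and> norm ((lift_map ^^ n) u - x) \<le> (1 - a) ^ n * norm (u - x)"
proof (induction n)
  case (Suc n)
  have "norm (lift_map ((lift_map ^^ n) u) - lift_map x) \<le> (1 - a) * norm ((lift_map ^^ n) u - x)"
    using Suc x by (intro sink_contraction[OF c(2)]) auto
  also have "\<dots> \<le> (1 - a) * ((1 - a) ^ n * norm (u - x))"
    using Suc a_less by (intro mult_left_mono) auto
  finally show ?case using Suc x sink_invariant[OF c] by simp
qed (use u in simp)

lemma negligible_trapped:
  assumes c: "cosines c \<in> unstable_cosines"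
  shows "negligible {v. \<forall>k. (lift_map ^^ k) v \<in> cball c r}" (is "negligible ?S")
proof -
  have nonpos: "hess (cosines c) (u - v) \<le> 0" if "u \<in> ?S" "v \<in> ?S" for u v
  proof (rule ccontr)
    define q where "q = (\<lambda>k. hess (cosines c) ((lift_map ^^ k) u - (lift_map ^^ k) v))"
    assume "\<not> hess (cosines c) (u - v) \<le> 0"
    then have q0: "q 0 > 0" by (simp add: q_def)
    have "q (Suc k) \<ge> (1 + a) * q k" for k
    proof -
      let ?u = "(lift_map ^^ k) u" and ?v = "(lift_map ^^ k) v"
      have "norm (lift_map ?u - lift_map ?v - tangent a (cosines c) (?u - ?v)) \<le> a / 600 * norm (?u - ?v)"
        using that by (intro lift_map_linearization) auto
      from hess_growth[OF a_pos a_less c this] show ?thesis by (simp add: q_def)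
    qed
    then have "(1 + a) ^ k * q 0 \<le> q k" for k
    proof (induction k)
      case (Suc k)
      have "(1 + a) * ((1 + a) ^ k * q 0) \<le> (1 + a) * q k"
        using Suc a_pos by (intro mult_left_mono) auto
      then show ?case using Suc.prems[of k] by simp
    qed simp
    moreover have "q k \<le> 5 * (2 * r)\<^sup>2" for k
    proof -
      let ?u = "(lift_map ^^ k) u" and ?v = "(lift_map ^^ k) v"
      have "dist c ?u \<le> r" "dist c ?v \<le> r" using that by auto
      then have "norm (?u - ?v) \<le> 2 * r"
        using dist_triangle2[of ?u ?v c] by (simp add: dist_norm norm_minus_commute)
      then have "(norm (?u - ?v))\<^sup>2 \<le> (2 * r)\<^sup>2" by (intro power_mono) auto
      \<comment> \<open>Taking 0 as base point in \<open>hess_perturb\<close> bounds the form itself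
        by 5 times the squared norm.\<close>
      moreover have "q k \<le> 5 * (norm (?u - ?v))\<^sup>2"
        using hess_perturb[OF c, of 0 "?u - ?v"] by (simp add: q_def hess_def split: prod.splits)
      ultimately show ?thesis by linarith
    qed
    moreover obtain k where "5 * (2 * r)\<^sup>2 / q 0 < (1 + a) ^ k"
      using real_arch_pow[of "1 + a"] a_pos by auto
    ultimately show False using q0 by (simp add: pos_divide_less_eq not_less[symmetric]) (meson not_less order_trans)
  qed
  obtain \<alpha> \<beta> where ab: "\<And>d. hess (cosines c) d \<le> 0 \<Longrightarrow> norm d \<le> 2 * \<bar>\<alpha> * fst d + \<beta> * snd d\<bar>"
    using hess_nonpos[OF c] by blast
  show ?thesis
  \<comment> \<open>The scalar projection is embedded in the plane as a vertical line, so that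
    source and target have the same dimension and the image is null.\<close>
  proof (rule negligible_if_expanding_into)
    show "negligible {v :: real \<times> real. v \<bullet> (1, 0) = 0}"
      using negligible_standard_hyperplane[of "(1, 0) :: real \<times> real" 0]
      by (simp add: Basis_prod_def inner_commute)
    show "(\<lambda>v. (0, \<alpha> * fst v + \<beta> * snd v)) ` ?S \<subseteq> {v :: real \<times> real. v \<bullet> (1, 0) = 0}"
      by auto
    show "norm (u - v) \<le> 2 * norm ((0 :: real, \<alpha> * fst u + \<beta> * snd u) - (0, \<alpha> * fst v + \<beta> * snd v))"
      if "u \<in> ?S" "v \<in> ?S" for u v
      using ab[OF nonpos[OF that]] by (simp add: norm_Pair algebra_simps)
  qed
qed

lemma negligible_lift_map_funpow_vimage:
  assumes "negligible N"
  shows "negligible ((lift_map ^^ n) -` N)"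
proof (induction n)
  case (Suc n)
  have "negligible (lift_map -` ((lift_map ^^ n) -` N))"
  proof (rule negligible_if_expanding_into[OF Suc])
    show "norm (u - v) \<le> 6 / (1 - 3 * a) * norm (lift_map u - lift_map v)" for u v
      using lift_map_lower_bound[of u v] a_less by (simp add: field_simps)
  qed auto
  then show ?case by (simp add: vimage_def funpow_swap1)
qed (use assms in simp)

text \<open>The field vanishes at \<open>c\<close> and is Lipschitz, so steps near a critical point
  are short. This prevents jumps between different unstable points.\<close>

lemma step_near_critical:
  assumes "sin_field c = 0" "dist v c < r"
  shows "dist v (lift_map v) < 1"
proof -
  have "norm (sin_field v) \<le> 6 * r"
    using sin_field_lipschitz[of v c] assms by (simp add: dist_norm)
  then have "norm (coupling (sin_field v)) \<le> 36 * r"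
    using norm_coupling_le[of "sin_field v"] by linarith
  then have "a * norm (coupling (sin_field v)) \<le> 1 * (36 * r)"
    using a_pos a_less by (intro mult_mono) auto
  moreover have "dist v (lift_map v) = norm (a *\<^sub>R coupling (sin_field v) + e v)"
    by (subst dist_commute) (simp add: lift_map_def dist_norm add.assoc)
  moreover have "norm (a *\<^sub>R coupling (sin_field v) + e v) \<le> a * norm (coupling (sin_field v)) + \<eta>"
    using norm_triangle_ineq[of "a *\<^sub>R coupling (sin_field v)" "e v"] e_bound[of v] a_pos by simp
  ultimately show ?thesis using \<eta>_small r_small r_pos a_less a_pos by linarith
qed

text \<open>An orbit that avoids the minima is finally near unstable points, and always near the
  same one because steps are short compared with their spacing. Hence some iterate is trapped for
  good, and the exceptional set lies in a countable union, over times and lattice points, of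
  preimages of null sets.\<close>

lemma negligible_not_attracted:
  assumes orbits: "\<And>v. \<exists>N. \<forall>k\<ge>N. \<exists>c. sin_field c = 0 \<and> dist ((lift_map ^^ k) v) c < r"
  shows "negligible {v. \<not> (\<exists>N c. sin_field c = 0 \<and> cosines c = synchronised_cosines \<and> dist ((lift_map ^^ N) v) c < r)}"
    (is "negligible ?B")
proof -
  define c where "c = (\<lambda>(m, n). (of_int m * pi, of_int n * pi))"
  \<comment> \<open>The guard makes every \<open>S p\<close> null by
    \<open>negligible_trapped\<close>, for all integer pairs alike.\<close>
  define S where "S = (\<lambda>p. if cosines (c p) \<in> unstable_cosines
      then {v. \<forall>k. (lift_map ^^ k) v \<in> cball (c p) r} else {})"
  have "negligible (\<Union>(N, p)\<in>UNIV. (lift_map ^^ N) -` S p)"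
  proof -
    have "(\<Union>(N, p)\<in>UNIV. (lift_map ^^ N) -` S p) \<in> null_sets lebesgue"
    proof (rule null_sets_UN')
      fix q :: "nat \<times> int \<times> int"
      have "negligible (S p)" for p
        using negligible_trapped by (simp add: S_def)
      then show "(case q of (N, p) \<Rightarrow> (lift_map ^^ N) -` S p) \<in> null_sets lebesgue"
        using negligible_lift_map_funpow_vimage by (auto simp: negligible_iff_null_sets split: prod.splits)
    qed simp
    then show ?thesis by (simp add: negligible_iff_null_sets)
  qed
  moreover have "?B \<subseteq> (\<Union>(N, p)\<in>UNIV. (lift_map ^^ N) -` S p)"
  proof
    fix v assume "v \<in> ?B"
    then have v: "cosines x \<noteq> synchronised_cosines" if "sin_field x = 0" "dist ((lift_map ^^ N) v) x < r" for N x
      using that by blast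
    obtain N where crit: "\<forall>k\<ge>N. \<exists>x. sin_field x = 0 \<and> dist ((lift_map ^^ k) v) x < r"
      using orbits by blast
    then have N: "\<exists>p. sin_field (c p) = 0 \<and> cosines (c p) \<in> unstable_cosines \<and> dist ((lift_map ^^ k) v) (c p) < r"
      if k: "k \<ge> N" for k
    proof -
      obtain x where x: "sin_field x = 0" "dist ((lift_map ^^ k) v) x < r"
        using crit k by blast
      then obtain m n :: int where "cosines x \<in> unstable_cosines" "x = (of_int m * pi, of_int n * pi)"
        using v[OF x] cosines_critical[OF x(1)] by blast
      moreover from this have "x = c (m, n)" by (simp add: c_def)
      ultimately show ?thesis using x by metis
    qed
    then obtain p where p: "cosines (c p) \<in> unstable_cosines" "dist ((lift_map ^^ N) v) (c p) < r" by blast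
    \<comment> \<open>Consecutive nearby centres are less than \<open>r + 1 + r < 2\<close> apart,
      whereas distinct ones differ by at least \<open>pi\<close> in some coordinate.\<close>
    have sep: "p = q" if "dist (c p) (c q) < 2" for p q
    proof -
      obtain m n m' n' where pq: "p = (m, n)" "q = (m', n')" by (metis prod.collapse)
      have i: "i = j" if "\<bar>of_int i * pi - of_int j * pi\<bar> < 2" for i j :: int
      proof (rule ccontr)
        assume "i \<noteq> j"
        then have "1 \<le> \<bar>real_of_int (i - j)\<bar>" by linarith
        then have "1 * pi \<le> \<bar>real_of_int (i - j)\<bar> * pi" by (intro mult_right_mono) auto
        also have "\<dots> = \<bar>of_int i * pi - of_int j * pi\<bar>" by (simp add: abs_mult left_diff_distrib[symmetric])
        finally show False using that pi_gt3 by simp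
      qed
      show ?thesis
        using that abs_fst_le_norm[of "c p - c q"] abs_snd_le_norm[of "c p - c q"]
        by (auto simp: pq c_def dist_norm intro!: i)
    qed
    have "dist ((lift_map ^^ k) v) (c p) < r" if "k \<ge> N" for k
      using that
    proof (induction k rule: dec_induct)
      case (step k)
      obtain q where q: "dist ((lift_map ^^ Suc k) v) (c q) < r" using N[of "Suc k"] step by auto
      obtain x where "sin_field x = 0" "dist ((lift_map ^^ k) v) x < r" using N[OF step.hyps(1)] by blast
      then have "dist ((lift_map ^^ k) v) ((lift_map ^^ Suc k) v) < 1"
        using step_near_critical by simp
      moreover have "dist (c p) (c q) \<le> dist (c p) ((lift_map ^^ k) v) + dist ((lift_map ^^ k) v) ((lift_map ^^ Suc k) v)
         + dist ((lift_map ^^ Suc k) v) (c q)"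
        using dist_triangle[of "c p" "c q" "(lift_map ^^ k) v"]
          dist_triangle[of "(lift_map ^^ k) v" "c q" "(lift_map ^^ Suc k) v"] by linarith
      ultimately have "dist (c p) (c q) < 2"
        using q step.IH r_small a_less by (simp add: dist_commute)
      then show ?case using sep q by blast
    qed (use p in simp)
    then have "(lift_map ^^ N) v \<in> S p"
    proof -
      have "dist (c p) ((lift_map ^^ k) ((lift_map ^^ N) v)) \<le> r" for k
        using \<open>\<And>k. k \<ge> N \<Longrightarrow> dist ((lift_map ^^ k) v) (c p) < r\<close>[of "k + N"]
        by (simp add: funpow_add dist_commute)
      then show ?thesis using p(1) by (simp add: S_def)
    qed
    then show "v \<in> (\<Union>(N, p)\<in>UNIV. (lift_map ^^ N) -` S p)"
      by (intro UN_I[of "(N, p)"]) simp_all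
  qed
  ultimately show ?thesis by (rule negligible_subset)
qed

end

subsection \<open>Dynamics on the torus\<close>

lemma torus_of_add_lattice: "l \<in> period_lattice \<Longrightarrow> torus_of (v + l) = torus_of v"
  by (simp add: torus_of_eq_iff)

text \<open>A closed fibre attains its distance to a point. With such a representative, estimates in
  the plane pass to the torus without loss.\<close>

lemma dist_torus_attained:
  obtains v where "torus_of v = q" "dist u v = dist (torus_of u) q"
proof -
  have "{w. torus_of w = q} \<noteq> {}" using torus_of_surj by auto
  then obtain v where "v \<in> {w. torus_of w = q}" "infdist u {w. torus_of w = q} = dist u v"
    using infdist_attains_inf[OF closed_torus_fibre] by metis
  then show thesis using that by (simp add: dist_torus_def setdist_torus_fibre)
qed

text \<open>Being purely topological, asymptotic stability survives conjugacy by a mere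
  homeomorphism, which need not preserve the hyperbolicity in \<open>sink\<close>.\<close>

lemma asymptotically_stable_conjugate:
  assumes h: "homeomorphism UNIV UNIV h k" and conj: "h \<circ> F = F' \<circ> h"
    and p: "asymptotically_stable F p"
  shows "asymptotically_stable F' (h p)"
proof -
  have hk: "h (k w) = w" and kh: "k (h z) = z" for w z
    using h by (auto simp: homeomorphism_def)
  have cont: "continuous_on UNIV h" "continuous_on UNIV k" using h by (auto simp: homeomorphism_def)
  have "F' (h z) = h (F z)" for z using fun_cong[OF conj, of z] by simp
  then have "(F' ^^ n) (h z) = h ((F ^^ n) z)" for n z by (induction n) auto
  then have iter: "(F' ^^ n) w = h ((F ^^ n) (k w))" for n w using hk by metis
  show ?thesis unfolding asymptotically_stable_def
  proof (intro conjI allI impI)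
    fix U assume U: "open U \<and> h p \<in> U"
    then have "open (h -` U)" "p \<in> h -` U" using cont by (auto intro: open_vimage)
    then obtain V where V: "open V" "p \<in> V" "\<forall>z\<in>V. \<forall>n. (F ^^ n) z \<in> h -` U"
      using p unfolding asymptotically_stable_def by meson
    have "open (k -` V)" using V cont by (auto intro: open_vimage)
    then show "\<exists>V. open V \<and> h p \<in> V \<and> (\<forall>z\<in>V. \<forall>n. (F' ^^ n) z \<in> U)"
      using V kh by (intro exI[of _ "k -` V"]) (auto simp: iter)
  next
    obtain U where U: "open U" "p \<in> U" "\<forall>z\<in>U. (\<lambda>n. (F ^^ n) z) \<longlonglongrightarrow> p"
      using p unfolding asymptotically_stable_def by blast
    have "open (k -` U)" using U cont by (auto intro: open_vimage)
    moreover have "(\<lambda>n. (F' ^^ n) z) \<longlonglongrightarrow> h p" if "z \<in> k -` U" for z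
      unfolding iter
      by (rule continuous_on_tendsto_compose[OF cont(1)]) (use U that in auto)
    ultimately show "\<exists>U. open U \<and> h p \<in> U \<and> (\<forall>z\<in>U. (\<lambda>n. (F' ^^ n) z) \<longlonglongrightarrow> h p)"
      using U kh by (intro exI[of _ "k -` U"]) auto
  qed
qed

lemma approaches_exponentially_tendsto:
  assumes "approaches_exponentially F z p"
  shows "(\<lambda>n. (F ^^ n) z) \<longlonglongrightarrow> p"
proof -
  obtain C \<rho> where C: "0 < \<rho>" "\<rho> < 1" "\<And>n. dist ((F ^^ n) z) p \<le> C * \<rho> ^ n"
    using assms unfolding approaches_exponentially_def by blast
  have "(\<lambda>n. C * \<rho> ^ n) \<longlonglongrightarrow> C * 0"
    using C(1,2) by (intro tendsto_mult_left LIMSEQ_power_zero) simp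
  then have lim: "(\<lambda>n. C * \<rho> ^ n) \<longlonglongrightarrow> 0" by simp
  have "(\<lambda>n. dist ((F ^^ n) z) p) \<longlonglongrightarrow> 0"
    by (rule tendsto_sandwich[OF _ _ tendsto_const lim]) (simp_all add: C(3))
  then show ?thesis by (subst tendsto_dist_iff)
qed

lemma approaches_exponentially_funpow:
  assumes "approaches_exponentially F ((F ^^ N) z) p"
  shows "approaches_exponentially F z p"
proof -
  obtain C \<rho> where C: "0 < C" "0 < \<rho>" "\<rho> < 1" "\<And>n. dist ((F ^^ n) ((F ^^ N) z)) p \<le> C * \<rho> ^ n"
    using assms unfolding approaches_exponentially_def by blast
  define S where "S = (\<Sum>k<N. dist ((F ^^ k) z) p)"
  have S: "0 \<le> S" unfolding S_def by (intro sum_nonneg) auto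
  \<comment> \<open>The sum \<open>S\<close> covers the first \<open>N\<close> terms, for which
    \<open>\<rho> ^ n / \<rho> ^ N\<close> is at least 1; the division by \<open>\<rho> ^ N\<close>
    undoes the time shift for the others.\<close>
  have "dist ((F ^^ n) z) p \<le> ((C + S) / \<rho> ^ N) * \<rho> ^ n" for n
  proof (cases "n < N")
    case True
    have "dist ((F ^^ n) z) p \<le> S"
      unfolding S_def by (rule member_le_sum) (use True in auto)
    also have "\<dots> \<le> (C + S) * 1" using C by simp
    also have "\<dots> \<le> (C + S) * (\<rho> ^ n / \<rho> ^ N)"
      using C S True power_decreasing[of n N \<rho>] by (intro mult_left_mono) auto
    finally show ?thesis by simp
  next
    case False
    then obtain m where m: "n = m + N" by (metis add.commute le_Suc_ex not_less)
    have "dist ((F ^^ n) z) p \<le> C * \<rho> ^ m" using C(4)[of m] by (simp add: m funpow_add)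
    also have "\<dots> \<le> (C + S) * \<rho> ^ m" using S C by (intro mult_right_mono) auto
    also have "\<dots> = ((C + S) / \<rho> ^ N) * \<rho> ^ n" using C by (simp add: m power_add)
    finally show ?thesis .
  qed
  moreover have "(C + S) / \<rho> ^ N > 0" using C S by auto
  ultimately show ?thesis using C unfolding approaches_exponentially_def by blast
qed

text \<open>A Lipschitz estimate at a single base point passes to the derivative there. It transfers
  the contraction rate of the lift to its derivative at a sink.\<close>

lemma has_derivative_norm_le:
  fixes f :: "'a::real_normed_vector \<Rightarrow> 'b::real_normed_vector"
  assumes f: "(f has_derivative A) (at x)" and U: "open U" "x \<in> U"
    and L: "\<And>y. y \<in> U \<Longrightarrow> norm (f y - f x) \<le> L * norm (y - x)"
  shows "norm (A v) \<le> L * norm v"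
proof -
  interpret A: bounded_linear A using f by (rule has_derivative_bounded_linear)
  obtain \<rho> where \<rho>: "\<rho> > 0" "ball x \<rho> \<subseteq> U" using U open_contains_ball by blast
  have "norm (A v) \<le> L * norm v + \<epsilon>" if "\<epsilon> > 0" for \<epsilon>
  proof (cases "v = 0")
    case False
    define \<epsilon>' where "\<epsilon>' = \<epsilon> / norm v"
    have "\<epsilon>' > 0" using False that by (simp add: \<epsilon>'_def)
    then obtain d where d: "d > 0" "\<And>y. norm (y - x) < d \<Longrightarrow> norm (f y - f x - A (y - x)) \<le> \<epsilon>' * norm (y - x)"
      using f unfolding has_derivative_at_alt by blast
    \<comment> \<open>Half of the smaller radius, measured along \<open>v\<close>: the test point
      stays in \<open>U\<close> and in the range of the differentiability estimate.\<close>
    define t where "t = min d \<rho> / (2 * norm v)"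
    have t: "t > 0" "t * norm v < d" "t * norm v < \<rho>"
      using False d(1) \<rho>(1) by (auto simp: t_def field_simps min_def)
    define y where "y = x + t *\<^sub>R v"
    have y: "y - x = t *\<^sub>R v" "norm (y - x) = t * norm v" using t(1) by (simp_all add: y_def)
    have "y \<in> U" using \<rho>(2) t(3) y(2) by (auto simp: dist_norm norm_minus_commute)
    have "norm (A (y - x)) \<le> norm (f y - f x) + norm (f y - f x - A (y - x))"
      using norm_triangle_ineq4[of "f y - f x" "f y - f x - A (y - x)"] by simp
    also have "\<dots> \<le> L * (t * norm v) + \<epsilon>' * (t * norm v)"
      using L[OF \<open>y \<in> U\<close>] d(2)[of y] t(2) unfolding y(2) by (intro add_mono) auto
    also have "\<dots> = t * (L * norm v + \<epsilon>)" using False by (simp add: \<epsilon>'_def field_simps)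
    finally show ?thesis using t(1) by (simp add: y(1) A.scaleR)
  qed (use that in \<open>simp add: A.zero\<close>)
  then show ?thesis by (rule field_le_epsilon)
qed

locale perturbed_torus_map = perturbed_lift +
  fixes T :: "torus \<Rightarrow> torus"
  assumes T_torus_of: "T (torus_of v) = torus_of (lift_map v)"
begin

lemma T_funpow_torus_of: "(T ^^ n) (torus_of v) = torus_of ((lift_map ^^ n) v)"
  by (induction n) (auto simp: T_torus_of)

lemma lift_map_lipschitz: "norm (lift_map u - lift_map v) \<le> 14 * norm (u - v)"
proof -
  have "lift_map u - lift_map v = (u - v) + a *\<^sub>R coupling (sin_field u - sin_field v) + (e u - e v)"
    by (simp add: lift_map_def coupling_diff scaleR_diff_right)
  then have "norm (lift_map u - lift_map v) \<le> norm (u - v) + norm (a *\<^sub>R coupling (sin_field u - sin_field v)) + norm (e u - e v)"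
    by (simp only:) (intro order_trans[OF norm_triangle_ineq] add_right_mono norm_triangle_ineq)
  moreover have "norm (coupling (sin_field u - sin_field v)) \<le> 36 * norm (u - v)"
    using norm_coupling_le[of "sin_field u - sin_field v"] sin_field_lipschitz[of u v] by linarith
  then have "a * norm (coupling (sin_field u - sin_field v)) \<le> 1/3 * (36 * norm (u - v))"
    using a_pos a_less by (intro mult_mono) auto
  moreover have "norm (e u - e v) \<le> 1 * norm (u - v)"
    using e_lipschitz[of u v] \<eta>_less a_pos mult_right_mono[of \<eta> 1 "norm (u - v)"] by simp
  ultimately show ?thesis using a_pos by simp
qed

lemma continuous_T: "continuous_on UNIV T"
proof (rule continuous_onI)
  fix z and \<epsilon> :: real assume "\<epsilon> > 0"
  have "dist (T y) (T z) \<le> 14 * dist y z" for y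
  proof -
    obtain u where u: "y = torus_of u" using torus_of_surj by metis
    obtain v where v: "torus_of v = z" "dist u v = dist (torus_of u) z" by (rule dist_torus_attained)
    have "dist (T y) (T z) \<le> dist (lift_map u) (lift_map v)"
      unfolding u v(1)[symmetric] T_torus_of by (rule dist_torus_of_le)
    also have "\<dots> \<le> 14 * dist u v" using lift_map_lipschitz by (simp add: dist_norm)
    finally show ?thesis using v u by simp
  qed
  then have "dist (T y) (T z) \<le> \<epsilon>" if "dist y z < \<epsilon> / 14" for y
    using that order_trans[of "dist (T y) (T z)" "14 * dist y z" \<epsilon>] by simp
  then show "\<exists>d>0. \<forall>y\<in>UNIV. dist y z < d \<longrightarrow> dist (T y) (T z) \<le> \<epsilon>"
    using \<open>\<epsilon> > 0\<close> by (intro exI[of _ "\<epsilon> / 14"]) auto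
qed

lemma continuous_T_funpow: "continuous_on UNIV (T ^^ n)"
proof (induction n)
  case (Suc n)
  have "continuous_on UNIV (T \<circ> (T ^^ n))"
    by (intro continuous_on_compose Suc continuous_on_subset[OF continuous_T]) auto
  then show ?case by simp
qed (simp add: continuous_on_id)

context
  fixes c x :: "real \<times> real"
  assumes c: "sin_field c = 0" "cosines c = synchronised_cosines"
    and x: "dist c x \<le> r / 2" "lift_map x = x"
begin

lemma x_mem: "x \<in> cball c r"
  using x r_pos by simp

lemma approaches_near_sink:
  assumes "dist (torus_of c) z \<le> r"
  shows "approaches_exponentially T z (torus_of x)"
proof -
  obtain u where u: "torus_of u = z" "dist c u = dist (torus_of c) z" by (rule dist_torus_attained)
  have "dist ((T ^^ n) z) (torus_of x) \<le> (2 * r) * (1 - a) ^ n" for n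
  proof -
    have "dist ((T ^^ n) z) (torus_of x) \<le> dist ((lift_map ^^ n) u) x"
      unfolding u(1)[symmetric] T_funpow_torus_of by (rule dist_torus_of_le)
    also have "\<dots> \<le> (1 - a) ^ n * norm (u - x)"
      using sink_orbit[OF c x_mem x(2), of u n] u assms by (simp add: dist_norm)
    also have "\<dots> \<le> (1 - a) ^ n * (2 * r)"
      using dist_triangle2[of u x c] u assms x r_pos a_less
      by (intro mult_left_mono) (auto simp: dist_norm norm_minus_commute)
    finally show ?thesis by (simp add: mult.commute)
  qed
  then show ?thesis unfolding approaches_exponentially_def
    using r_pos a_pos a_less by (intro exI[of _ "2 * r"] exI[of _ "1 - a"] conjI allI) auto
qed

text \<open>Within \<open>r / 2\<close> of the fixed point the distance to it never increases,
  because this ball lies in the region of contraction around \<open>c\<close>. Small balls are thus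
  forward invariant, and convergence is the exponential approach.\<close>

lemma asymptotically_stable_sink: "asymptotically_stable T (torus_of x)"
proof -
  have contr: "dist ((T ^^ n) z) (torus_of x) \<le> dist z (torus_of x)" if "dist (torus_of x) z \<le> r / 2" for z n
  proof -
    obtain u where u: "torus_of u = z" "dist x u = dist (torus_of x) z" by (rule dist_torus_attained)
    have "dist c u \<le> r" using dist_triangle[of c u x] x u that by linarith
    then have "dist ((lift_map ^^ n) u) x \<le> (1 - a) ^ n * norm (u - x)"
      using sink_orbit[OF c x_mem x(2), of u n] by (simp add: dist_norm)
    also have "\<dots> \<le> 1 * norm (u - x)"
      using a_pos a_less by (intro mult_right_mono power_le_one) auto
    finally have "dist ((lift_map ^^ n) u) x \<le> dist (torus_of x) z"
      using u by (simp add: dist_norm norm_minus_commute)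
    then show ?thesis
      using dist_torus_of_le[of "(lift_map ^^ n) u" x] unfolding u(1)[symmetric] T_funpow_torus_of
      by (simp add: dist_commute)
  qed
  have near: "dist (torus_of c) z \<le> r" if "dist (torus_of x) z \<le> r / 2" for z
    using dist_triangle[of "torus_of c" z "torus_of x"] dist_torus_of_le[of c x] x that by linarith
  show ?thesis unfolding asymptotically_stable_def
  proof (intro conjI allI impI)
    fix U assume "open U \<and> torus_of x \<in> U"
    then obtain \<rho> where \<rho>: "\<rho> > 0" "ball (torus_of x) \<rho> \<subseteq> U" using open_contains_ball by blast
    have "(T ^^ n) z \<in> U" if "z \<in> ball (torus_of x) (min \<rho> (r / 2))" for z n
      using contr[of z n] that \<rho>(2) by (auto simp: dist_commute subset_iff)
    then show "\<exists>V. open V \<and> torus_of x \<in> V \<and> (\<forall>z\<in>V. \<forall>n. (T ^^ n) z \<in> U)"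
      using \<rho>(1) r_pos by (intro exI[of _ "ball (torus_of x) (min \<rho> (r / 2))"]) auto
  next
    have "(\<lambda>n. (T ^^ n) z) \<longlonglongrightarrow> torus_of x" if "z \<in> ball (torus_of x) (r / 2)" for z
      using that by (intro approaches_exponentially_tendsto approaches_near_sink near) auto
    then show "\<exists>U. open U \<and> torus_of x \<in> U \<and> (\<forall>z\<in>U. (\<lambda>n. (T ^^ n) z) \<longlonglongrightarrow> torus_of x)"
      using r_pos by (intro exI[of _ "ball (torus_of x) (r / 2)"]) auto
  qed
qed

text \<open>Every complex eigenvalue has modulus at most \<open>1 - a\<close>, since the derivative
  inherits the contraction rate of the lift.\<close>

lemma sink_torus_of:
  assumes e: "e differentiable (at x)"
  shows "sink T (torus_of x)"
proof -
  have "(\<lambda>v. coupling (sin_field v)) differentiable (at x)"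
  proof -
    have "((\<lambda>v. coupling (sin_field v)) has_derivative
       (\<lambda>d. coupling (linear_field (cosines x) d))) (at x)"
      unfolding coupling_def sin_field_def linear_field_def cosines_def
      by (auto intro!: derivative_eq_intros simp: algebra_simps)
    then show ?thesis by (auto simp: differentiable_def)
  qed
  then have "lift_map differentiable (at x)"
    unfolding lift_map_def using e by (intro derivative_intros) auto
  then obtain A where A: "(lift_map has_derivative A) (at x)" by (auto simp: differentiable_def)
  have A_le: "norm (A v) \<le> (1 - a) * norm v" for v
  proof (rule has_derivative_norm_le[OF A open_ball])
    show "x \<in> ball c r" using x r_pos by simp
    show "norm (lift_map y - lift_map x) \<le> (1 - a) * norm (y - x)" if "y \<in> ball c r" for y
      using that x_mem by (intro sink_contraction[OF c(2)]) auto
  qed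
  have "cmod z \<noteq> 1" if "complex_eigenvalue A z" for z
  proof -
    obtain u v where uv: "(u, v) \<noteq> (0, 0)" "A u = Re z *\<^sub>R u - Im z *\<^sub>R v" "A v = Im z *\<^sub>R u + Re z *\<^sub>R v"
      using \<open>complex_eigenvalue A z\<close> unfolding complex_eigenvalue_def by blast
    define s where "s = (norm u)\<^sup>2 + (norm v)\<^sup>2"
    have "s > 0" using uv(1) by (auto simp: s_def sum_power2_gt_zero_iff)
    \<comment> \<open>The real form of the fact that \<open>A\<close> multiplies the squared norm of
      the complex eigenvector \<open>u + i v\<close> by the squared modulus of
      \<open>z\<close>.\<close>
    have "(norm (A u))\<^sup>2 + (norm (A v))\<^sup>2 = ((Re z)\<^sup>2 + (Im z)\<^sup>2) * s"
      unfolding uv s_def power2_norm_eq_inner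
      by (simp add: inner_diff inner_add inner_commute power2_eq_square algebra_simps)
    moreover have "(norm (A w))\<^sup>2 \<le> (1 - a)\<^sup>2 * (norm w)\<^sup>2" for w
      using power_mono[OF A_le[of w], of 2] by (simp add: power_mult_distrib)
    then have "(norm (A u))\<^sup>2 + (norm (A v))\<^sup>2 \<le> (1 - a)\<^sup>2 * s"
      by (simp add: s_def distrib_left add_mono)
    ultimately have "(cmod z)\<^sup>2 \<le> (1 - a)\<^sup>2" using \<open>s > 0\<close> by (simp add: cmod_power2)
    also have "\<dots> < 1\<^sup>2" by (rule power_strict_mono) (use a_pos a_less in auto)
    finally show ?thesis by auto
  qed
  moreover have "torus_has_derivative T A (torus_of x)"
    unfolding torus_has_derivative_def using A T_torus_of by blast
  moreover have "T (torus_of x) = torus_of x" by (simp add: T_torus_of x)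
  ultimately have "hyperbolic_fixed_point T (torus_of x)"
    unfolding hyperbolic_fixed_point_def by blast
  then show ?thesis using asymptotically_stable_sink by (simp add: sink_def)
qed

end

end

lemma synchronised_states:
  fixes c :: "real \<times> real"
  assumes "c = (2 * pi / 3, 4 * pi / 3) \<or> c = (4 * pi / 3, 2 * pi / 3)"
  shows "sin_field c = 0" "cosines c = synchronised_cosines"
proof -
  have A: "cos (2 * pi / 3) = - 1/2" "sin (2 * pi / 3) = sqrt 3 / 2"
    using cos_120 sin_120 by (simp_all add: mult.commute)
  have B_eq: "4 * pi / 3 = 2 * pi - 2 * pi / 3" by simp
  have B: "cos (4 * pi / 3) = - 1/2" "sin (4 * pi / 3) = - (sqrt 3 / 2)"
    unfolding B_eq cos_diff sin_diff A by simp_all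
  have *: "sin_field (x, y) = 0 \<and> cosines (x, y) = synchronised_cosines"
    if "cos x = - 1/2" "cos y = - 1/2" "sin y = - sin x" "sin x * sin x = 3/4" for x y
    using that by (simp add: sin_field_def cosines_def synchronised_cosines_def sin_diff cos_diff zero_prod_def)
  have "sin_field c = 0 \<and> cosines c = synchronised_cosines"
    using assms A B by (elim disjE; hypsubst; intro *; simp only: A B) auto
  then show "sin_field c = 0" "cosines c = synchronised_cosines" by auto
qed

section \<open>Almost every point is attracted, and there are exactly two sinks\<close>

context perturbed_torus_map
begin

text \<open>Defined by entry into open balls instead of convergence, so that continuity of the
  iterates makes it open and hence Borel.\<close>

definition attracted :: "torus set" where
  "attracted = (\<Union>N. (T ^^ N) -`
     (ball (torus_of (2 * pi / 3, 4 * pi / 3)) r \<union> ball (torus_of (4 * pi / 3, 2 * pi / 3)) r))"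

lemma open_attracted: "open attracted"
  unfolding attracted_def by (intro open_UN ballI open_vimage continuous_T_funpow open_Un open_ball)

context
  assumes orbits: "\<And>v. \<exists>N. \<forall>k\<ge>N. \<exists>c. sin_field c = 0 \<and> dist ((lift_map ^^ k) v) c < r"
begin

lemma negligible_lift_not_attracted: "negligible {v. torus_of v \<notin> attracted}"
proof (rule negligible_subset[OF negligible_not_attracted[OF orbits]], safe)
  fix v N c assume v: "torus_of v \<notin> attracted"
    and c: "sin_field c = 0" "cosines c = synchronised_cosines" "dist ((lift_map ^^ N) v) c < r"
  have "torus_of c = torus_of (2 * pi / 3, 4 * pi / 3) \<or> torus_of c = torus_of (4 * pi / 3, 2 * pi / 3)"
    using synchronised_critical[OF c(1,2)] by (simp add: torus_of_eq_iff)
  moreover have "(T ^^ N) (torus_of v) \<in> ball (torus_of c) r"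
    using dist_torus_of_le[of "(lift_map ^^ N) v" c] c(3) by (simp add: T_funpow_torus_of dist_commute)
  ultimately have "torus_of v \<in> attracted" by (auto simp: attracted_def)
  with v show False by simp
qed

lemma AE_attracted: "AE z in torus_lebesgue. z \<in> attracted"
proof -
  let ?Q = "{0..<2 * pi} \<times> {0..<2 * pi} :: (real \<times> real) set"
  let ?N = "{v. torus_of v \<notin> attracted}"
  have "?N = torus_of -` (- attracted)" by auto
  \<comment> \<open>Negligibility gives a null set of the completed measure only; closedness makes
    the set Borel, hence null for \<open>lborel\<close> itself.\<close>
  moreover have "closed (torus_of -` (- attracted))"
    using open_attracted continuous_on_torus_of by (intro closed_vimage) auto
  ultimately have "?N \<in> sets lborel" by simp
  moreover have "?N \<in> null_sets (completion lborel)"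
    using negligible_lift_not_attracted by (simp add: negligible_iff_null_sets)
  ultimately have "?N \<in> null_sets lborel" by (simp add: null_sets_completion_iff)
  then have "AE v in lborel. torus_of v \<in> attracted"
    by (rule AE_I') auto
  moreover have Q: "?Q \<in> sets lborel" by (simp add: borel_Times)
  ultimately have "AE v in restrict_space lborel ?Q. torus_of v \<in> attracted"
    by (subst AE_restrict_space_iff) auto
  moreover have "{z \<in> space borel. z \<in> attracted} \<in> sets borel" using open_attracted by simp
  ultimately show ?thesis
    unfolding torus_lebesgue_def by (subst AE_distr_iff[OF measurable_torus_of]) auto
qed

lemma two_sinks:
  assumes e: "\<And>v. e differentiable (at v)"
  obtains p q where "p \<noteq> q" "sink T p" "sink T q"
    "\<And>z. asymptotically_stable T z \<Longrightarrow> z = p \<or> z = q"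
    "AE z in torus_lebesgue. approaches_exponentially T z p \<or> approaches_exponentially T z q"
proof -
  let ?P = "(2 * pi / 3, 4 * pi / 3) :: real \<times> real" and ?Q = "(4 * pi / 3, 2 * pi / 3) :: real \<times> real"
  have P: "sin_field ?P = 0" "cosines ?P = synchronised_cosines"
    and Q: "sin_field ?Q = 0" "cosines ?Q = synchronised_cosines"
    by (simp_all add: synchronised_states)
  obtain x where x: "dist ?P x \<le> r / 2" "lift_map x = x" by (rule sink_fixed_point[OF P])
  obtain y where y: "dist ?Q y \<le> r / 2" "lift_map y = y" by (rule sink_fixed_point[OF Q])
  let ?p = "torus_of x" and ?q = "torus_of y"
  have attr: "approaches_exponentially T z ?p \<or> approaches_exponentially T z ?q" if z: "z \<in> attracted" for z
  proof -
    obtain N where "(T ^^ N) z \<in> ball (torus_of ?P) r \<or> (T ^^ N) z \<in> ball (torus_of ?Q) r"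
      using z by (auto simp: attracted_def)
    then have "approaches_exponentially T ((T ^^ N) z) ?p \<or> approaches_exponentially T ((T ^^ N) z) ?q"
      using approaches_near_sink[OF P x, of "(T ^^ N) z"] approaches_near_sink[OF Q y, of "(T ^^ N) z"]
      by (auto simp: less_imp_le)
    then show ?thesis using approaches_exponentially_funpow by blast
  qed
  show thesis
  proof (rule that[of ?p ?q])
    show "sink T ?p" by (rule sink_torus_of[OF P x e])
    show "sink T ?q" by (rule sink_torus_of[OF Q y e])
    \<comment> \<open>The first coordinates lie within \<open>r / 2\<close> of
      \<open>2 * pi / 3\<close> and \<open>4 * pi / 3\<close>. Equality on the torus would put a
      multiple of \<open>2 * pi\<close> within \<open>r < 1\<close> of \<open>- 2 * pi / 3\<close>,
      forcing an integer strictly between -1 and 0.\<close>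
    show "?p \<noteq> ?q"
    proof
      assume "?p = ?q"
      then obtain m n :: int where m: "fst x = fst y + 2 * pi * of_int m"
        unfolding torus_of_eq_iff by (elim diff_in_period_latticeE)
      have "\<bar>2 * pi / 3 - fst x\<bar> \<le> r / 2" "\<bar>4 * pi / 3 - fst y\<bar> \<le> r / 2"
        using x(1) y(1) abs_fst_le_norm[of "?P - x"] abs_fst_le_norm[of "?Q - y"]
        by (auto simp: dist_norm)
      then have "\<bar>2 * pi * of_int m + 2 * pi / 3\<bar> \<le> r" using m by linarith
      moreover have "r < 1" using r_small a_less a_pos by linarith
      ultimately have "2 * pi * of_int m < 0" "2 * pi * (of_int m + 1) > 0"
        using pi_gt3 by (auto simp: abs_le_iff algebra_simps)
      then have "of_int m < (0::real)" "of_int m + 1 > (0::real)"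
        by (simp_all add: mult_less_0_iff zero_less_mult_iff)
      then have "m < 0" "real_of_int (m + 1) > 0" by simp_all
      then show False by (simp only: of_int_0_less_iff)
    qed
    show "z = ?p \<or> z = ?q" if "asymptotically_stable T z" for z
    proof -
      obtain U where U: "open U" "z \<in> U" "\<forall>w\<in>U. (\<lambda>n. (T ^^ n) w) \<longlonglongrightarrow> z"
        using \<open>asymptotically_stable T z\<close> unfolding asymptotically_stable_def by blast
      have "open (torus_of -` U)" by (rule open_vimage[OF U(1) continuous_on_torus_of])
      moreover have "torus_of -` U \<noteq> {}" using U(2) torus_of_surj[of z] by blast
      ultimately have "\<not> torus_of -` U \<subseteq> {v. torus_of v \<notin> attracted}"
        using open_not_negligible negligible_subset[OF negligible_lift_not_attracted] by blast
      then obtain v where v: "torus_of v \<in> U" "torus_of v \<in> attracted" by auto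
      then have "(\<lambda>n. (T ^^ n) (torus_of v)) \<longlonglongrightarrow> z" using U by blast
      then show ?thesis
        using attr[OF v(2)] approaches_exponentially_tendsto LIMSEQ_unique by metis
    qed
    show "AE z in torus_lebesgue. approaches_exponentially T z ?p \<or> approaches_exponentially T z ?q"
      by (rule AE_mp[OF AE_attracted]) (use attr in auto)
  qed
qed

end

end

section \<open>From the given torus maps to the perturbed lift\<close>

lemma G_map_torus_of: "G_map a (torus_of v) = torus_of (v + a *\<^sub>R coupling (sin_field v))"
proof -
  have "sin (snd v - fst v) = - sin (fst v - snd v)" by (metis minus_diff_eq sin_minus)
  then show ?thesis
    by (cases v) (simp add: G_map.abs_eq coupling_def sin_field_def algebra_simps)
qed

text \<open>Every point has a translate of norm at most \<open>4 * pi < 16\<close>, so the ball of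
  radius 20 also contains the same translate of any point at distance less than 1. For such pairs
  the mean value theorem on the ball applies; for pairs at distance at least 1 the sup bound
  suffices.\<close>

lemma C1_torus_bounds:
  assumes "C1_torus \<zeta>"
  obtains K where "K > 0" "\<And>v. \<bar>\<zeta> (torus_of v)\<bar> \<le> K"
    "\<And>u v. \<bar>\<zeta> (torus_of u) - \<zeta> (torus_of v)\<bar> \<le> K * norm (u - v)"
    "\<And>v. (\<lambda>w. \<zeta> (torus_of w)) differentiable (at v)"
proof -
  obtain \<zeta>' :: "real \<times> real \<Rightarrow> (real \<times> real) \<Rightarrow>\<^sub>L real" where cont: "continuous_on UNIV \<zeta>'"
    and deriv: "\<And>v. ((\<lambda>w. \<zeta> (torus_of w)) has_derivative blinfun_apply (\<zeta>' v)) (at v)"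
    using assms unfolding C1_torus_def by blast
  let ?f = "\<lambda>v. \<zeta> (torus_of v)"
  let ?K = "cball 0 20 :: (real \<times> real) set"
  have f: "continuous_on ?K ?f"
    using deriv by (meson continuous_at_imp_continuous_on has_derivative_continuous)
  have "bounded (?f ` ?K)" "bounded (\<zeta>' ` ?K)"
    using f continuous_on_subset[OF cont] by (auto intro!: compact_imp_bounded compact_continuous_image)
  then obtain B L where BL: "\<forall>y\<in>?f ` ?K. norm y \<le> B" "\<forall>y\<in>\<zeta>' ` ?K. norm y \<le> L"
    unfolding bounded_iff by blast
  have B: "norm (?f v) \<le> B" and L: "norm (\<zeta>' v) \<le> L" if "v \<in> ?K" for v
    using BL that by blast+
  define K where "K = max 1 (max (2 * B) L)"
  have K: "K > 0" "2 * B \<le> K" "L \<le> K" by (auto simp: K_def)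
  have "0 \<le> B" using B[of 0] by (meson norm_ge_zero order_trans centre_in_cball zero_le_numeral)
  have translate: "\<exists>l\<in>period_lattice. norm (v + l) \<le> 16" for v
  proof -
    obtain l where l: "l \<in> period_lattice" "v + l \<in> {0..<2 * pi} \<times> {0..<2 * pi}"
      by (rule period_lattice_translate)
    then have "norm (v + l) \<le> 4 * pi"
      using norm_prod_le_abs[of "v + l"] by (auto simp: mem_Times_iff)
    then have "norm (v + l) \<le> 16" using pi_less_4 by linarith
    then show ?thesis using l by blast
  qed
  have bound: "\<bar>?f v\<bar> \<le> B" for v
  proof -
    obtain l where "l \<in> period_lattice" "norm (v + l) \<le> 16" using translate by blast
    then show ?thesis using B[of "v + l"] by (simp add: torus_of_add_lattice)
  qed
  have lip: "\<bar>?f u - ?f v\<bar> \<le> K * norm (u - v)" for u v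
  proof (cases "norm (u - v) < 1")
    case True
    obtain l where l: "l \<in> period_lattice" "norm (u + l) \<le> 16" using translate by blast
    have "norm (v + l) \<le> norm (u + l) + norm (u - v)"
      using norm_triangle_ineq4[of "u + l" "u - v"] by (simp add: algebra_simps)
    then have "u + l \<in> ?K" "v + l \<in> ?K" using l True by auto
    then have "norm (?f (u + l) - ?f (v + l)) \<le> L * norm ((u + l) - (v + l))"
      using deriv L
      by (intro differentiable_bound[where S = ?K and f' = "\<lambda>v. blinfun_apply (\<zeta>' v)"])
        (auto simp: has_derivative_at_withinI norm_blinfun.rep_eq[symmetric])
    also have "\<dots> \<le> K * norm ((u + l) - (v + l))" using K by (intro mult_right_mono) auto
    finally show ?thesis using l by (simp add: torus_of_add_lattice)
  next
    case False
    have "\<bar>?f u - ?f v\<bar> \<le> 2 * B" using bound[of u] bound[of v] by linarith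
    also have "\<dots> \<le> K * 1" using K by simp
    also have "\<dots> \<le> K * norm (u - v)" using False K by (intro mult_left_mono) auto
    finally show ?thesis .
  qed
  show thesis
  proof (rule that[OF K(1) _ lip])
    show "\<bar>?f v\<bar> \<le> K" for v using bound[of v] K \<open>0 \<le> B\<close> by linarith
    show "?f differentiable (at v)" for v
      using deriv unfolding differentiable_def by blast
  qed
qed

theorem corollary2:
  fixes a :: real and \<zeta>1 \<zeta>2 :: "torus \<Rightarrow> real"
  assumes "0 < a" and "a < 1 / 3"
    and "C1_torus \<zeta>1" and "C1_torus \<zeta>2"
  shows "\<exists>\<epsilon>>0. \<forall>\<delta>1 \<delta>2 :: real. \<bar>\<delta>1\<bar> + \<bar>\<delta>2\<bar> < \<epsilon> \<longrightarrow>
    (\<exists>p q. p \<noteq> q \<and> {z. sink (G_pert a \<zeta>1 \<zeta>2 \<delta>1 \<delta>2) z} = {p, q} \<and>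
      (\<forall>h k. homeomorphism UNIV UNIV h k \<and> h \<circ> G_map a = G_pert a \<zeta>1 \<zeta>2 \<delta>1 \<delta>2 \<circ> h \<longrightarrow>
         {p, q} = {h (torus_of (2 * pi / 3, 4 * pi / 3)), h (torus_of (4 * pi / 3, 2 * pi / 3))}) \<and>
      (AE z in torus_lebesgue.
         approaches_exponentially (G_pert a \<zeta>1 \<zeta>2 \<delta>1 \<delta>2) z p \<or>
         approaches_exponentially (G_pert a \<zeta>1 \<zeta>2 \<delta>1 \<delta>2) z q))"
proof -
  let ?P = "(2 * pi / 3, 4 * pi / 3) :: real \<times> real" and ?Q = "(4 * pi / 3, 2 * pi / 3) :: real \<times> real"
  obtain K1 where K1: "K1 > 0" "\<And>v. \<bar>\<zeta>1 (torus_of v)\<bar> \<le> K1"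
    "\<And>u v. \<bar>\<zeta>1 (torus_of u) - \<zeta>1 (torus_of v)\<bar> \<le> K1 * norm (u - v)"
    "\<And>v. (\<lambda>w. \<zeta>1 (torus_of w)) differentiable (at v)"
    using C1_torus_bounds[OF assms(3)] by blast
  obtain K2 where K2: "K2 > 0" "\<And>v. \<bar>\<zeta>2 (torus_of v)\<bar> \<le> K2"
    "\<And>u v. \<bar>\<zeta>2 (torus_of u) - \<zeta>2 (torus_of v)\<bar> \<le> K2 * norm (u - v)"
    "\<And>v. (\<lambda>w. \<zeta>2 (torus_of w)) differentiable (at v)"
    using C1_torus_bounds[OF assms(4)] by blast
  define r where "r = a / 40000"
  have r: "r > 0" using assms by (simp add: r_def)
  obtain \<eta>0 where \<eta>0: "\<eta>0 > 0"
    "\<And>z :: nat \<Rightarrow> real \<times> real. (\<And>k. norm (z (Suc k) - (z k + a *\<^sub>R coupling (sin_field (z k)))) \<le> \<eta>0) \<Longrightarrow>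
       \<exists>N. \<forall>k\<ge>N. \<exists>c. sin_field c = 0 \<and> dist (z k) c < r"
    by (rule pseudo_orbit_near_critical[OF assms(1,2) r]) blast
  \<comment> \<open>\<open>\<eta>0\<close> serves the confinement of orbits, the other two bounds
    are those of the locale \<open>perturbed_lift\<close>.\<close>
  define \<eta>1 where "\<eta>1 = min \<eta>0 (min (a * r / 2) ((1 - 3 * a) / 6))"
  have \<eta>1: "\<eta>1 > 0" "\<eta>1 \<le> \<eta>0" "\<eta>1 \<le> a * r / 2" "6 * \<eta>1 \<le> 1 - 3 * a"
  proof -
    have "\<eta>1 \<le> (1 - 3 * a) / 6" unfolding \<eta>1_def by (rule min.coboundedI2[OF min.cobounded2])
    then show "6 * \<eta>1 \<le> 1 - 3 * a" by simp
  qed (use \<eta>0 r assms in \<open>auto simp: \<eta>1_def\<close>)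
  define K where "K = max K1 K2"
  have K: "K > 0" "K1 \<le> K" "K2 \<le> K" using K1 by (auto simp: K_def)
  \<comment> \<open>The instance without perturbation, in which the critical points themselves are
    the fixed points, yields the stability of the two states under \<open>G_map a\<close>.\<close>
  have lift0: "perturbed_lift a 0 r (\<lambda>_. 0)"
    by unfold_locales (use assms r in \<open>auto simp: r_def\<close>)
  interpret unperturbed: perturbed_torus_map a 0 r "\<lambda>_. 0" "G_map a"
    by (intro perturbed_torus_map.intro lift0 perturbed_torus_map_axioms.intro)
      (simp add: G_map_torus_of perturbed_lift.lift_map_def[OF lift0])
  have "asymptotically_stable (G_map a) (torus_of c)"
    if "sin_field c = 0" "cosines c = synchronised_cosines" for c
    by (rule unperturbed.asymptotically_stable_sink[OF that])
      (use r that in \<open>simp_all add: unperturbed.lift_map_def coupling_def zero_prod_def[symmetric]\<close>)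
  then have stable: "asymptotically_stable (G_map a) (torus_of ?P)" "asymptotically_stable (G_map a) (torus_of ?Q)"
    by (simp_all add: synchronised_states)
  show ?thesis
  proof (intro exI[of _ "\<eta>1 / K"] conjI allI impI)
    show "\<eta>1 / K > 0" using \<eta>1 K by simp
    fix \<delta>1 \<delta>2 :: real assume \<delta>: "\<bar>\<delta>1\<bar> + \<bar>\<delta>2\<bar> < \<eta>1 / K"
    define e where "e = (\<lambda>v. (\<delta>1 * \<zeta>1 (torus_of v), \<delta>2 * \<zeta>2 (torus_of v)))"
    define T where "T = G_pert a \<zeta>1 \<zeta>2 \<delta>1 \<delta>2"
    have \<delta>K: "(\<bar>\<delta>1\<bar> + \<bar>\<delta>2\<bar>) * K \<le> \<eta>1" using \<delta> K by (simp add: field_simps)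
    have scaled: "norm (\<delta>1 * s, \<delta>2 * t) \<le> \<eta>1 * M" if "\<bar>s\<bar> \<le> K1 * M" "\<bar>t\<bar> \<le> K2 * M" "M \<ge> 0" for s t M
    proof -
      have "K1 * M \<le> K * M" "K2 * M \<le> K * M" using K that(3) by (auto intro!: mult_right_mono)
      then have "\<bar>\<delta>1\<bar> * \<bar>s\<bar> \<le> \<bar>\<delta>1\<bar> * (K * M)" "\<bar>\<delta>2\<bar> * \<bar>t\<bar> \<le> \<bar>\<delta>2\<bar> * (K * M)"
        using that by (auto intro!: mult_left_mono)
      then have "norm (\<delta>1 * s, \<delta>2 * t) \<le> ((\<bar>\<delta>1\<bar> + \<bar>\<delta>2\<bar>) * K) * M"
        using norm_prod_le_abs[of "(\<delta>1 * s, \<delta>2 * t)"] by (simp add: abs_mult algebra_simps)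
      also have "\<dots> \<le> \<eta>1 * M" using \<delta>K that(3) by (rule mult_right_mono)
      finally show ?thesis .
    qed
    have e_bound: "norm (e v) \<le> \<eta>1" for v
      using scaled[of "\<zeta>1 (torus_of v)" 1 "\<zeta>2 (torus_of v)"] K1 K2 by (simp add: e_def)
    have e_lip: "norm (e u - e v) \<le> \<eta>1 * norm (u - v)" for u v
      using scaled[of "\<zeta>1 (torus_of u) - \<zeta>1 (torus_of v)" "norm (u - v)" "\<zeta>2 (torus_of u) - \<zeta>2 (torus_of v)"] K1 K2
      by (simp add: e_def algebra_simps)
    have lift: "perturbed_lift a \<eta>1 r e"
      by unfold_locales (use assms r \<eta>1 e_bound e_lip in \<open>auto simp: r_def e_def torus_of_add_lattice\<close>)
    interpret perturbed_torus_map a \<eta>1 r e T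
    proof (intro perturbed_torus_map.intro lift perturbed_torus_map_axioms.intro)
      fix v
      have "T (torus_of v) = torus_of (v + a *\<^sub>R coupling (sin_field v)) + torus_of (e v)"
        by (simp add: T_def G_pert_def G_map_torus_of e_def)
      then show "T (torus_of v) = torus_of (perturbed_lift.lift_map a e v)"
        by (simp add: perturbed_lift.lift_map_def[OF lift] plus_torus.abs_eq)
    qed
    have orbits: "\<exists>N. \<forall>k\<ge>N. \<exists>c. sin_field c = 0 \<and> dist ((lift_map ^^ k) v) c < r" for v
    proof (rule \<eta>0(2))
      show "norm ((lift_map ^^ Suc k) v - ((lift_map ^^ k) v + a *\<^sub>R coupling (sin_field ((lift_map ^^ k) v)))) \<le> \<eta>0" for k
        using order_trans[OF e_bound \<eta>1(2)] by (simp add: lift_map_def)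
    qed
    have e_diff: "e differentiable (at v)" for v
      unfolding e_def using K1(4) K2(4) by (intro differentiable_Pair) auto
    obtain p q where pq: "p \<noteq> q" "sink T p" "sink T q"
      "\<And>z. asymptotically_stable T z \<Longrightarrow> z = p \<or> z = q"
      "AE z in torus_lebesgue. approaches_exponentially T z p \<or> approaches_exponentially T z q"
      using two_sinks[OF orbits e_diff] by blast
    \<comment> \<open>Both images are asymptotically stable, hence among \<open>p\<close> and
      \<open>q\<close>; they are distinct because \<open>h\<close> is injective, so they exhaust the
      pair.\<close>
    have "{p, q} = {h (torus_of ?P), h (torus_of ?Q)}"
      if hk: "homeomorphism UNIV UNIV h k" "h \<circ> G_map a = T \<circ> h" for h k
    proof -
      have "h (torus_of ?P) \<in> {p, q}" "h (torus_of ?Q) \<in> {p, q}"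
        using pq(4) asymptotically_stable_conjugate[OF hk] stable by blast+
      moreover have "torus_of ?P \<noteq> torus_of ?Q"
      proof
        assume "torus_of ?P = torus_of ?Q"
        then obtain m :: int where "fst ?P = fst ?Q + 2 * pi * of_int m"
          unfolding torus_of_eq_iff by (elim diff_in_period_latticeE)
        then have "pi * (of_int (3 * m + 1)) = 0" by (simp add: algebra_simps)
        then have "real_of_int (3 * m + 1) = 0" by (simp only: mult_eq_0_iff pi_neq_zero simp_thms)
        then have "3 * m + 1 = 0" by linarith
        then show False by presburger
      qed
      then have "h (torus_of ?P) \<noteq> h (torus_of ?Q)" using hk(1) by (metis homeomorphism_def UNIV_I)
      ultimately show ?thesis by auto
    qed
    moreover have "{z. sink T z} = {p, q}" using pq(2-4) by (auto simp: sink_def)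
    ultimately show "\<exists>p q. p \<noteq> q \<and> {z. sink (G_pert a \<zeta>1 \<zeta>2 \<delta>1 \<delta>2) z} = {p, q} \<and>
      (\<forall>h k. homeomorphism UNIV UNIV h k \<and> h \<circ> G_map a = G_pert a \<zeta>1 \<zeta>2 \<delta>1 \<delta>2 \<circ> h \<longrightarrow>
         {p, q} = {h (torus_of ?P), h (torus_of ?Q)}) \<and>
      (AE z in torus_lebesgue.
         approaches_exponentially (G_pert a \<zeta>1 \<zeta>2 \<delta>1 \<delta>2) z p \<or>
         approaches_exponentially (G_pert a \<zeta>1 \<zeta>2 \<delta>1 \<delta>2) z q)"
      unfolding T_def[symmetric] using pq(1,5) by blast
  qed
qed

end
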